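(* Let $k$, $m$ and $r$ be integers with $m \ge 2$ and $r \ge 3$. Let $G$ be an $r$-regular graph of even order, and let $M$ be a matching in $G$ with $|M| = m$ such that there exist $k$ edge-disjoint odd ears of $V(M)$ in $G$. If $m \ge r$, assume further that no vertex of $V(G) \setminus V(M)$ is adjacent to at least $r-1$ vertices of $V(M)$. If one of the following holds, then $M$ extends to a perfect matching of $G$: (i) $k = mr - \left\lceil \frac{r}{2} \right\rceil + 1$ and $\lambda_c(G) \ge mr-m+\theta$, where $\theta = 1$ when both $m$ and $r$ are even and $\theta = 0$ otherwise; or (ii) $k = mr-r+1$ and $\lambda_{oc}(G) \ge (2m-1)(r-1)$.
   Context: All graphs are finite and simple. $V(M)$ is the set of endvertices of the edges of $M$. A set $F$ of edges of a graph $G$ is a cyclic edge cut if $G-F$ has two components each of which contains a cycle. The cyclic edge-connectivity $\lambda_c(G)$ is the size of a minimum cyclic edge cut of $G$; if $G$ has no cyclic edge cut, $\lambda_c(G)=\infty$. $F$ is an odd-cyclic edge cut if $F$ is a cyclic edge cut such that a component of $G-F$ contains a cycle of odd length. $\lambda_{oc}(G)$ denotes the size of a minimum odd-cyclic edge cut of $G$; if $G$ has no odd-cyclic edge cut, $\lambda_{oc}(G)=\infty$. For $U \subseteq V(G)$, an ear of $U$ is either a path having both endvertices but no internal vertices in $U$, or a cycle having exactly one vertex in $U$ (in particular, every edge joining two vertices of $U$ is an ear of $U$). An ear is odd if it contains an odd number of edges. A matching $M$ of $G$ extends to a perfect matching if there is a perfect matching $M^*$ of $G$ with $M \subseteq M^*$.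 *)

theory Defs
  imports Complex_Main "HOL-Library.Extended_Nat" "HOL-Library.Disjoint_Sets"
begin

(* A graph is a vertex set V with a set E of two-element subsets of V. *)
definition simple_graph :: "'a set \<Rightarrow> 'a set set \<Rightarrow> bool" where
  "simple_graph V E \<longleftrightarrow> finite V \<and> (\<forall>e\<in>E. e \<subseteq> V \<and> card e = 2)"

definition regular :: "'a set \<Rightarrow> 'a set set \<Rightarrow> nat \<Rightarrow> bool" where
  "regular V E r \<longleftrightarrow> (\<forall>v\<in>V. card {e \<in> E. v \<in> e} = r)"

definition matching :: "'a set set \<Rightarrow> 'a set set \<Rightarrow> bool" where
  "matching E M \<longleftrightarrow> M \<subseteq> E \<and> disjoint M"

definition perfect_matching :: "'a set \<Rightarrow> 'a set set \<Rightarrow> 'a set set \<Rightarrow> bool" where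
  "perfect_matching V E M \<longleftrightarrow> matching E M \<and> \<Union>M = V"

definition extends_to_perfect_matching :: "'a set \<Rightarrow> 'a set set \<Rightarrow> 'a set set \<Rightarrow> bool" where
  "extends_to_perfect_matching V E M \<longleftrightarrow> (\<exists>M'. perfect_matching V E M' \<and> M \<subseteq> M')"

fun walk_edges :: "'a list \<Rightarrow> 'a set list" where
  "walk_edges (u # v # p) = {u, v} # walk_edges (v # p)"
| "walk_edges _ = []"

definition is_path :: "'a set \<Rightarrow> 'a set set \<Rightarrow> 'a list \<Rightarrow> bool" where
  "is_path V E p \<longleftrightarrow> p \<noteq> [] \<and> distinct p \<and> set p \<subseteq> V \<and> set (walk_edges p) \<subseteq> E"

(* A cycle is listed with its initial vertex repeated at the end. *)
definition is_cycle :: "'a set \<Rightarrow> 'a set set \<Rightarrow> 'a list \<Rightarrow> bool" where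
  "is_cycle V E c \<longleftrightarrow> length (walk_edges c) \<ge> 3 \<and> hd c = last c \<and> distinct (tl c) \<and>
     set c \<subseteq> V \<and> set (walk_edges c) \<subseteq> E"

(* Components are given by their vertex sets. *)
definition components :: "'a set \<Rightarrow> 'a set set \<Rightarrow> 'a set set" where
  "components V E = (\<lambda>v. {u \<in> V. (v, u) \<in> {(x, y). {x, y} \<in> E}\<^sup>*}) ` V"

definition cyclic_edge_cut :: "'a set \<Rightarrow> 'a set set \<Rightarrow> 'a set set \<Rightarrow> bool" where
  "cyclic_edge_cut V E F \<longleftrightarrow> F \<subseteq> E \<and>
     (\<exists>C \<in> components V (E - F). \<exists>D \<in> components V (E - F). C \<noteq> D \<and>
        (\<exists>c. is_cycle V (E - F) c \<and> set c \<subseteq> C) \<and>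
        (\<exists>d. is_cycle V (E - F) d \<and> set d \<subseteq> D))"

definition odd_cyclic_edge_cut :: "'a set \<Rightarrow> 'a set set \<Rightarrow> 'a set set \<Rightarrow> bool" where
  "odd_cyclic_edge_cut V E F \<longleftrightarrow> cyclic_edge_cut V E F \<and>
     (\<exists>C \<in> components V (E - F). \<exists>c. is_cycle V (E - F) c \<and> set c \<subseteq> C \<and>
        odd (length (walk_edges c)))"

(* In enat the infimum of a nonempty set is its minimum, and that of the empty set is \<infinity>. *)
definition cyclic_edge_connectivity :: "'a set \<Rightarrow> 'a set set \<Rightarrow> enat" where
  "cyclic_edge_connectivity V E = (INF F \<in> {F. cyclic_edge_cut V E F}. enat (card F))"

definition odd_cyclic_edge_connectivity :: "'a set \<Rightarrow> 'a set set \<Rightarrow> enat" where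
  "odd_cyclic_edge_connectivity V E = (INF F \<in> {F. odd_cyclic_edge_cut V E F}. enat (card F))"

definition ear :: "'a set \<Rightarrow> 'a set set \<Rightarrow> 'a set \<Rightarrow> 'a list \<Rightarrow> bool" where
  "ear V E U p \<longleftrightarrow>
     (is_path V E p \<and> hd p \<in> U \<and> last p \<in> U \<and> set (butlast (tl p)) \<inter> U = {}) \<or>
     (is_cycle V E p \<and> card (set p \<inter> U) = 1)"

definition odd_ear :: "'a set \<Rightarrow> 'a set set \<Rightarrow> 'a set \<Rightarrow> 'a list \<Rightarrow> bool" where
  "odd_ear V E U p \<longleftrightarrow> ear V E U p \<and> odd (length (walk_edges p))"

(* An odd ear has an edge, so edge-disjointness prevents two vertex lists of
   the same ear (its reversal, or a rotation of a cycle) from being counted twice. *)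
definition edge_disjoint_odd_ears ::
    "'a set \<Rightarrow> 'a set set \<Rightarrow> 'a set \<Rightarrow> 'a list set \<Rightarrow> bool" where
  "edge_disjoint_odd_ears V E U P \<longleftrightarrow> (\<forall>p\<in>P. odd_ear V E U p) \<and>
     pairwise (\<lambda>p q. set (walk_edges p) \<inter> set (walk_edges q) = {}) P"

end

theory Submission
  imports Defs
begin

text \<open>Let \<open>U = V(M)\<close>. If \<open>G - U\<close> has no perfect matching, Tutte's theorem gives \<open>S\<close> such that
  \<open>G - U - S\<close> splits into at least \<open>|S| + 2\<close> odd parts. Choosing the number of parts maximal, every
  part is a single vertex or contains an odd cycle. Put \<open>A = U \<union> S\<close>. An odd ear of \<open>U\<close> uses an edge
  inside \<open>A\<close> or two boundary edges of a non-singleton part, so counting the degrees in \<open>A\<close> bounds the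
  number \<open>t\<close> of singletons: \<open>2k + rt \<le> r(2m + |S|)\<close>. Hence \<open>t \<le> |S|\<close> in case (i) and \<open>t \<le> |S| + 1\<close> in
  case (ii). Two parts with cycles would have boundaries that are cyclic edge cuts, and these need
  more edges than leave \<open>A\<close> (up to parity in case (i)). In case (ii) with a single such part \<open>C\<close>, its
  boundary is too small for an odd-cyclic edge cut, so \<open>G - C\<close> is a forest; this forces \<open>m \<ge> r\<close>, and
  then the singletons, each having two neighbours in \<open>S\<close>, span a cycle with \<open>S\<close>.\<close>

section \<open>Tutte's theorem\<close>

text \<open>Halmos-Vaughan induction on the number of indices. A tight proper subfamily is
  represented first and its union removed from the other sets; without one, every proper nonempty
  subfamily has an element to spare, so an arbitrary first choice is harmless.\<close>

lemma hall:
  assumes "finite I" and "\<And>i. i \<in> I \<Longrightarrow> finite (A i)"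
    and "\<And>J. J \<subseteq> I \<Longrightarrow> card J \<le> card (\<Union>(A ` J))"
  shows "\<exists>f. inj_on f I \<and> (\<forall>i\<in>I. f i \<in> A i)"
  using assms
proof (induction "card I" arbitrary: I A rule: less_induct)
  case less
  show ?case
  proof (cases "\<exists>J. J \<subset> I \<and> J \<noteq> {} \<and> card (\<Union>(A ` J)) \<le> card J")
    case True
    then obtain J where J: "J \<subset> I" "J \<noteq> {}" "card (\<Union>(A ` J)) \<le> card J" by blast
    have fJ: "finite J" using J less.prems(1) finite_subset by blast
    have fUJ: "finite (\<Union>(A ` J))" using fJ J(1) less.prems(2) by blast
    have "card J < card I" using J(1) less.prems(1) psubset_card_mono by blast
    then obtain f where f: "inj_on f J" "\<forall>i\<in>J. f i \<in> A i"
      using less.hyps[of J A] fJ J(1) less.prems(2,3) by (metis psubsetE subset_trans subsetD)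
    define B where "B i = A i - \<Union>(A ` J)" for i
    have "card (I - J) < card I"
      using J less.prems(1) by (intro psubset_card_mono) auto
    \<comment> \<open>Hall's condition is applied to \<open>J \<union> K\<close>. As
      \<open>J\<close> is tight, its union accounts for at most \<open>card J\<close> elements, and
      the rest must come from \<open>B\<close>.\<close>
    moreover have "card K \<le> card (\<Union>(B ` K))" if K: "K \<subseteq> I - J" for K
    proof -
      have fK: "finite K" using K less.prems(1) finite_subset by blast
      have "card J + card K = card (J \<union> K)"
        using K fJ fK by (subst card_Un_disjoint) auto
      also have "\<dots> \<le> card (\<Union>(A ` (J \<union> K)))"
        using less.prems(3)[of "J \<union> K"] K J(1) by auto
      also have "\<Union>(A ` (J \<union> K)) = \<Union>(A ` J) \<union> \<Union>(B ` K)"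
        unfolding B_def by blast
      also have "card \<dots> \<le> card (\<Union>(A ` J)) + card (\<Union>(B ` K))" by (rule card_Un_le)
      finally show ?thesis using J(3) by linarith
    qed
    ultimately obtain g where g: "inj_on g (I - J)" "\<forall>i\<in>I - J. g i \<in> B i"
      using less.hyps[of "I - J" B] less.prems(1,2) unfolding B_def
      by (metis (no_types, lifting) DiffD1 finite_Diff)
    define h where "h i = (if i \<in> J then f i else g i)" for i
    have "inj_on h I"
    proof (rule inj_onI)
      fix x y assume xy: "x \<in> I" "y \<in> I" "h x = h y"
      have ne: "f u \<noteq> g v" if "u \<in> J" "v \<in> I - J" for u v
      proof
        assume "f u = g v"
        moreover have "f u \<in> \<Union>(A ` J)" using f(2) that(1) by auto
        moreover have "g v \<notin> \<Union>(A ` J)" using g(2) that(2) unfolding B_def by auto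
        ultimately show False by simp
      qed
      show "x = y"
        using xy f(1) g(1) ne[of x y] ne[of y x] unfolding h_def inj_on_def
        by (auto split: if_splits)
    qed
    moreover have "\<forall>i\<in>I. h i \<in> A i" using f g unfolding h_def B_def by auto
    ultimately show ?thesis by blast
  next
    case False
    show ?thesis
    proof (cases "I = {}")
      case True then show ?thesis by simp
    next
      case nonempty: False
      then obtain i where i: "i \<in> I" by blast
      then have "A i \<noteq> {}" using less.prems(3)[of "{i}"] by auto
      then obtain a where a: "a \<in> A i" by blast
      define B where "B j = A j - {a}" for j
      have "card (I - {i}) < card I"
        using i less.prems(1) by (intro psubset_card_mono) auto
      moreover have "card K \<le> card (\<Union>(B ` K))" if K: "K \<subseteq> I - {i}" for K
      proof (cases "K = {}")
        case False
        then have "card K < card (\<Union>(A ` K))"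
          using \<open>\<not> (\<exists>J. _ J)\<close> K i by (metis Diff_iff insertI1 not_le psubsetI subset_Diff_insert
              subset_iff Diff_empty)
        also have "\<Union>(A ` K) \<subseteq> insert a (\<Union>(B ` K))" unfolding B_def by blast
        then have "card (\<Union>(A ` K)) \<le> card (insert a (\<Union>(B ` K)))"
        proof (rule card_mono[rotated])
          show "finite (insert a (\<Union>(B ` K)))"
            using K less.prems(1,2) finite_subset[of K I] unfolding B_def by auto
        qed
        also have "\<dots> \<le> Suc (card (\<Union>(B ` K)))" by (rule card_insert_le_m1) auto
        finally show ?thesis by linarith
      qed simp
      ultimately obtain g where g: "inj_on g (I - {i})" "\<forall>j\<in>I - {i}. g j \<in> B j"
        using less.hyps[of "I - {i}" B] less.prems(1,2) unfolding B_def
        by (metis (no_types, lifting) DiffD1 finite_Diff)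
      have "inj_on (g(i := a)) I"
        using g unfolding inj_on_def B_def by auto
      moreover have "\<forall>j\<in>I. (g(i := a)) j \<in> A j" using g a unfolding B_def by auto
      ultimately show ?thesis by blast
    qed
  qed
qed

section \<open>Barriers: counting, extension and refinement\<close>

lemma disjoint_insertI:
  assumes "disjoint P" and "\<And>B. B \<in> P \<Longrightarrow> A \<inter> B = {}"
  shows "disjoint (insert A P)"
  using assms by (auto simp: disjoint_def)

text \<open>The parts need not be connected, which allows even components to be absorbed into odd parts.\<close>

definition barrier :: "'a set set \<Rightarrow> 'a set \<Rightarrow> 'a set \<Rightarrow> 'a set set \<Rightarrow> bool" where
  "barrier E X S P \<longleftrightarrow> S \<subseteq> X \<and> partition_on (X - S) P \<and> (\<forall>C\<in>P. odd (card C)) \<and>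
     (\<forall>e\<in>E. e \<subseteq> X - S \<longrightarrow> (\<exists>C\<in>P. e \<subseteq> C))"

lemma barrierD:
  assumes "barrier E X S P"
  shows "S \<subseteq> X" and "\<Union>P = X - S" and "disjoint P" and "{} \<notin> P"
    and "\<And>C. C \<in> P \<Longrightarrow> odd (card C)"
    and "\<And>C. C \<in> P \<Longrightarrow> C \<subseteq> X - S"
    and "\<And>C D. C \<in> P \<Longrightarrow> D \<in> P \<Longrightarrow> C \<noteq> D \<Longrightarrow> C \<inter> D = {}"
    and "\<And>e. e \<in> E \<Longrightarrow> e \<subseteq> X - S \<Longrightarrow> \<exists>C\<in>P. e \<subseteq> C"
  using assms unfolding barrier_def partition_on_def disjoint_def by auto

lemma barrierI:
  assumes "S \<subseteq> X" and "\<Union>P = X - S" and "disjoint P"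
    and "\<And>C. C \<in> P \<Longrightarrow> odd (card C)"
    and "\<And>e. e \<in> E \<Longrightarrow> e \<subseteq> X - S \<Longrightarrow> \<exists>C\<in>P. e \<subseteq> C"
  shows "barrier E X S P"
proof -
  have "{} \<notin> P" using assms(4) by force
  then show ?thesis using assms unfolding barrier_def partition_on_def by simp
qed

lemma barrier_finite:
  assumes "barrier E X S P" and "finite X"
  shows "finite S" and "finite P" and "C \<in> P \<Longrightarrow> finite C"
  using assms finite_elements[of "X - S" P] unfolding barrier_def partition_on_def
  by (auto intro: finite_subset)

text \<open>Odd parts are nonempty. The bound is what allows a barrier with the greatest number of
  parts to be chosen later.\<close>

lemma barrier_card_le:
  assumes "barrier E X S P" and "finite X"
  shows "card P \<le> card X"
proof -
  have "card P = (\<Sum>C\<in>P. 1)" by simp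
  also have "\<dots> \<le> (\<Sum>C\<in>P. card C)"
    using assms unfolding barrier_def by (intro sum_mono) (auto simp: Suc_le_eq intro: odd_pos)
  also have "\<dots> = card (X - S)"
    using assms barrier_finite[OF assms] card_Union_disjoint[of P]
    unfolding barrier_def partition_on_def by (auto simp: disjoint_def pairwise_def disjnt_def)
  also have "\<dots> \<le> card X" using assms(2) by (intro card_mono) auto
  finally show ?thesis .
qed

text \<open>\<open>X\<close> is the disjoint union of \<open>S\<close> and odd parts. For even
  \<open>card X\<close> it follows that a barrier with more parts than separating vertices has at
  least two more.\<close>

lemma barrier_parity:
  assumes "barrier E X S P" and "finite X"
  shows "even (card X + card S + card P)"
proof -
  have "card (X - S) = (\<Sum>C\<in>P. card C)"
    using assms barrier_finite[OF assms] card_Union_disjoint[of P]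
    unfolding barrier_def partition_on_def by (auto simp: disjoint_def pairwise_def disjnt_def)
  moreover have "even (\<Sum>C\<in>P. card C) \<longleftrightarrow> even (card P)"
    using assms barrier_finite[OF assms] unfolding barrier_def
    by (simp add: even_sum_iff)
      (metis (mono_tags, lifting) Collect_cong Collect_mem_eq)
  moreover have "card (X - S) + card S = card X"
    using assms barrier_finite[OF assms] unfolding barrier_def
    by (simp add: card_Diff_subset card_mono)
  ultimately show ?thesis by (metis even_add)
qed

text \<open>The vertices outside \<open>S\<close> and \<open>Q\<close> form a set \<open>L\<close>
  with no edge to \<open>Q\<close>. An odd \<open>L\<close> becomes a further part; an even
  \<open>L\<close> is merged into some part of \<open>Q\<close>, which keeps that part odd.\<close>

lemma barrier_extend:
  assumes "finite X" and "S \<subseteq> X" and "\<Union>Q \<subseteq> X - S" and "disjoint Q" and "Q \<noteq> {}"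
    and "\<And>C. C \<in> Q \<Longrightarrow> odd (card C)"
    and "\<And>e C. e \<in> E \<Longrightarrow> e \<subseteq> X - S \<Longrightarrow> C \<in> Q \<Longrightarrow> e \<inter> C \<noteq> {} \<Longrightarrow> e \<subseteq> C"
  shows "\<exists>P. barrier E X S P \<and> card Q \<le> card P"
proof -
  define L where "L = X - S - \<Union>Q"
  have fQ: "finite Q" using assms(1,3) by (meson finite_Diff finite_UnionD finite_subset)
  have ne: "{} \<notin> Q" using assms(6) by force
  obtain C where C: "C \<in> Q" using assms(5) by blast
  have fC: "finite C" using assms(6)[OF C] card.infinite by force
  have L: "e \<subseteq> L" if "e \<in> E" "e \<subseteq> X - S" "\<forall>C\<in>Q. \<not> e \<subseteq> C" for e
    using that assms(7) unfolding L_def by blast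
  show ?thesis
  proof (cases "even (card L)")
    case True
    define P where "P = insert (C \<union> L) (Q - {C})"
    have dCL: "(C \<union> L) \<inter> D = {}" if "D \<in> Q - {C}" for D
    proof -
      have "C \<inter> D = {}" using disjointD[OF assms(4) C, of D] that by auto
      moreover have "L \<inter> D = {}" using that unfolding L_def by auto
      ultimately show ?thesis by auto
    qed
    have "C \<union> L \<notin> Q - {C}" using dCL ne C by fastforce
    then have "card P = card Q" using fQ C unfolding P_def
      by (metis card_insert_disjoint card.remove finite_Diff)
    moreover have "barrier E X S P"
    proof (rule barrierI)
      show "S \<subseteq> X" by fact
      show "\<Union>P = X - S" using assms(3) C unfolding P_def L_def by auto
      show "disjoint P" unfolding P_def
        using dCL by (intro disjoint_insertI pairwise_subset[OF assms(4)]) auto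
      show "\<exists>C\<in>P. e \<subseteq> C" if "e \<in> E" "e \<subseteq> X - S" for e
      proof (cases "\<exists>D\<in>Q. e \<subseteq> D")
        case True
        then obtain D where "D \<in> Q" "e \<subseteq> D" by blast
        then show ?thesis unfolding P_def by (cases "D = C") auto
      next
        case False
        then have "e \<subseteq> L" using L that by blast
        then show ?thesis unfolding P_def by auto
      qed
      have "odd (card (C \<union> L))"
        using True assms(6)[OF C] assms(1) fC C unfolding L_def
        by (subst card_Un_disjoint) auto
      then show "odd (card D)" if "D \<in> P" for D using that assms(6) unfolding P_def by auto
    qed
    ultimately show ?thesis by (metis order_refl)
  next
    case False
    then have "L \<noteq> {}" by auto
    then have "L \<notin> Q" unfolding L_def by auto
    then have "card Q \<le> card (insert L Q)" using fQ by simp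
    moreover have "barrier E X S (insert L Q)"
    proof (rule barrierI)
      show "S \<subseteq> X" by fact
      show "\<Union>(insert L Q) = X - S" using assms(3) unfolding L_def by auto
      show "disjoint (insert L Q)" using assms(4) by (intro disjoint_insertI) (auto simp: L_def)
      show "\<exists>C\<in>insert L Q. e \<subseteq> C" if "e \<in> E" "e \<subseteq> X - S" for e
        using L[OF that] by auto
      show "odd (card D)" if "D \<in> insert L Q" for D using that assms(6) False by auto
    qed
    ultimately show ?thesis by blast
  qed
qed

text \<open>A barrier inside one part replaces that part. This contradicts maximality twice: for
  parts that are not factor-critical in Tutte's theorem, and for bipartite parts later.\<close>

lemma barrier_refine:
  assumes X: "finite X" and b: "barrier E X S P" and C: "C \<in> P" and b': "barrier E C S' P'"
  shows "barrier E X (S \<union> S') (P - {C} \<union> P')"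
    and "card (S \<union> S') = card S + card S'"
    and "Suc (card (P - {C} \<union> P')) = card P + card P'"
proof -
  note fin = barrier_finite[OF b X]
  note fin' = barrier_finite[OF b' fin(3)[OF C]]
  note B = barrierD[OF b] and B' = barrierD[OF b']
  have CX: "C \<subseteq> X - S" using B(6) C .
  show "card (S \<union> S') = card S + card S'"
    using B'(1) CX fin(1) fin'(1) by (intro card_Un_disjoint) auto
  have dC: "D \<inter> C = {}" if "D \<in> P - {C}" for D using that B(7) C by auto
  have dP: "D \<inter> D' = {}" if "D \<in> P - {C}" "D' \<in> P'" for D D'
    using dC[OF that(1)] B'(6)[OF that(2)] by auto
  then have "(P - {C}) \<inter> P' = {}" using B'(4) by fastforce
  then show "Suc (card (P - {C} \<union> P')) = card P + card P'"
    using fin(2) fin'(2) card.remove[OF fin(2) C] by (simp add: card_Un_disjoint)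
  show "barrier E X (S \<union> S') (P - {C} \<union> P')"
  proof (rule barrierI)
    show "S \<union> S' \<subseteq> X" using B(1) B'(1) CX by auto
    have "\<Union>P = \<Union>(P - {C}) \<union> C" using C by auto
    moreover have "\<Union>(P - {C}) \<inter> C = {}" using dC by auto
    ultimately have "\<Union>(P - {C}) = X - S - C" using B(2) by auto
    then show "\<Union>(P - {C} \<union> P') = X - (S \<union> S')"
      using B'(1,2) CX by auto
    show "disjoint (P - {C} \<union> P')"
    proof (rule disjoint_union)
      show "disjoint (P - {C})" by (rule pairwise_subset[OF B(3)]) auto
      show "\<Union>(P - {C}) \<inter> \<Union>P' = {}" using dP by blast
    qed (rule B'(3))
    show "odd (card D)" if "D \<in> P - {C} \<union> P'" for D using that B(5) B'(5) by auto
    show "\<exists>D\<in>P - {C} \<union> P'. e \<subseteq> D" if e: "e \<in> E" "e \<subseteq> X - (S \<union> S')" for e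
    proof -
      obtain D where D: "D \<in> P" "e \<subseteq> D" using B(8)[OF e(1)] e(2) by auto
      show ?thesis
      proof (cases "D = C")
        case True
        then have "e \<subseteq> C - S'" using D e by auto
        then show ?thesis using B'(8)[OF e(1)] by auto
      qed (use D in auto)
    qed
  qed
qed

text \<open>If every barrier has at most as many parts as separating vertices, then a
  largest balanced one has factor-critical parts, and Hall's theorem matches its separating
  vertices into distinct parts.\<close>

theorem tutte:
  assumes "finite X" and "\<And>e. e \<in> E \<Longrightarrow> card e = 2" and "\<nexists>N. perfect_matching X E N"
  shows "\<exists>S P. barrier E X S P \<and> card S < card P"
  using assms(1,3)
proof (induction "card X" arbitrary: X rule: less_induct)
  case less
  note X = less.prems(1)
  show ?case
  proof (rule ccontr)
    assume no: "\<not> ?thesis"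
    have ne: "X \<noteq> {}"
      using less.prems(2) unfolding perfect_matching_def matching_def
      by (auto simp: disjoint_def)
    have evX: "even (card X)"
    proof (rule ccontr)
      assume "odd (card X)"
      then have "barrier E X {} {X}" by (intro barrierI) auto
      then show False using no by force
    qed
    obtain x where x: "x \<in> X" using ne by blast
    have "card X = Suc (card (X - {x}))" by (rule card.remove[OF X x])
    then have c: "odd (card (X - {x}))" using evX by simp
    then have b0: "barrier E X {x} {X - {x}}"
      using x by (intro barrierI) auto
    \<comment> \<open>\<open>Q\<close> collects the sizes of barriers that are at least balanced;
      since \<open>no\<close> forbids an excess of parts, these are exactly balanced. Separating a
      single vertex \<open>x\<close> shows \<open>Q 1\<close>.\<close>
    define Q where "Q n \<longleftrightarrow> (\<exists>S P. barrier E X S P \<and> card S \<le> card P \<and> card P = n)" for n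
    have Q1: "Q 1" unfolding Q_def using b0 by (intro exI[of _ "{x}"] exI[of _ "{X - {x}}"]) auto
    have Qb: "n \<le> card X" if "Q n" for n using that barrier_card_le X unfolding Q_def by blast
    obtain n where n: "Q n" "\<forall>n'. Q n' \<longrightarrow> n' \<le> n"
      using Nat.ex_has_greatest_nat[of Q 1 "card X"] Q1 Qb by (metis)
    then obtain S P where b: "barrier E X S P" and "card S \<le> card P" and cP: "card P = n"
      unfolding Q_def by blast
    then have SP: "card S = card P" using no by force
    note fin = barrier_finite[OF b X] and B = barrierD[OF b]
    \<comment> \<open>Each part is factor-critical. Otherwise the induction hypothesis gives a
      barrier of \<open>C - {c}\<close> whose excess is at least two by parity; adding
      \<open>c\<close> to its separating set still leaves enough parts to refine \<open>C\<close>
      into a balanced barrier with more parts.\<close>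
    have crit: "\<exists>N. perfect_matching (C - {c}) E N" if C: "C \<in> P" and c: "c \<in> C" for C c
    proof (rule ccontr)
      assume no': "\<not> ?thesis"
      have CX: "C \<subseteq> X" "odd (card C)" using B(5,6) C by auto
      have fC: "finite C" using fin(3)[OF C] .
      have "card (C - {c}) < card C" using fC c by (rule card_Diff1_less)
      also have "card C \<le> card X" using CX X card_mono by blast
      finally obtain S' P' where b': "barrier E (C - {c}) S' P'" and SP': "card S' < card P'"
        using less.hyps[of "C - {c}"] no' fC by auto
      have "card C = Suc (card (C - {c}))" by (rule card.remove[OF fC c])
      then have "even (card S' + card P')"
        using barrier_parity[OF b'] fC CX(2) by simp
      then have SP'': "card S' + 2 \<le> card P'" using SP' by presburger
      have b'': "barrier E C (insert c S') P'"
        using b' c unfolding barrier_def by (auto simp: Diff_insert2[symmetric])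
      have cS: "c \<notin> S'" "finite S'" using barrierD(1)[OF b'] barrier_finite[OF b'] fC by auto
      have "Q (card (P - {C} \<union> P'))"
        unfolding Q_def using barrier_refine[OF X b C b''] cS SP SP''
        by (intro exI[of _ "S \<union> insert c S'"] exI[of _ "P - {C} \<union> P'"]) auto
      then have "card (P - {C} \<union> P') \<le> card P" using n cP by blast
      then show False using barrier_refine(3)[OF X b C b''] SP'' by linarith
    qed
    define A where "A s = {C \<in> P. \<exists>c\<in>C. {s, c} \<in> E}" for s
    \<comment> \<open>Hall's condition for the parts adjacent to each separating vertex. If
      \<open>J\<close> violated it, \<open>J\<close> could leave the separating set: the parts in
      \<open>R\<close> have no edge to \<open>J\<close>, remain closed, and outnumber
      \<open>S - J\<close>.\<close>
    have "card J \<le> card (\<Union>(A ` J))" if J: "J \<subseteq> S" for J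
    proof (rule ccontr)
      assume "\<not> ?thesis"
      then have lt: "card (\<Union>(A ` J)) < card J" by simp
      have AP: "\<Union>(A ` J) \<subseteq> P" unfolding A_def by auto
      define R where "R = P - \<Union>(A ` J)"
      have fJ: "finite J" using J fin(1) finite_subset by blast
      have "card R = card P - card (\<Union>(A ` J))"
        unfolding R_def using fin(2) AP by (intro card_Diff_subset) (auto intro: finite_subset)
      moreover have "card (S - J) = card S - card J" using J fJ by (simp add: card_Diff_subset)
      moreover have "card J \<le> card S" using J fin(1) card_mono by blast
      ultimately have RS: "card (S - J) < card R" using lt SP by linarith
      have "\<exists>P'. barrier E X (S - J) P' \<and> card R \<le> card P'"
      proof (rule barrier_extend[OF X])
        show "S - J \<subseteq> X" using B(1) by blast
        show "\<Union>R \<subseteq> X - (S - J)" using B(2) unfolding R_def by blast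
        show "disjoint R" unfolding R_def by (rule pairwise_subset[OF B(3)]) auto
        show "R \<noteq> {}" using RS by auto
        show "odd (card C)" if "C \<in> R" for C using that B(5) unfolding R_def by auto
      next
        fix e C assume e: "e \<in> E" "e \<subseteq> X - (S - J)" and C: "C \<in> R" "e \<inter> C \<noteq> {}"
        obtain y where y: "y \<in> e" "y \<in> C" using C by blast
        obtain z where z: "e = {y, z}" using assms(2)[OF e(1)] y(1)
          by (metis card_2_iff doubleton_eq_iff insertE singletonD)
        have CP: "C \<in> P" "\<And>s. s \<in> J \<Longrightarrow> C \<notin> A s" using C(1) unfolding R_def by auto
        have "z \<notin> J" using CP y z e(1) unfolding A_def by (auto simp: insert_commute[of y z])
        then have "e \<subseteq> X - S" using e(2) z y B(6)[OF CP(1)] by auto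
        then obtain D where D: "D \<in> P" "e \<subseteq> D" using B(8)[OF e(1)] by auto
        then have "D = C" using y B(7)[OF D(1) CP(1)] by auto
        then show "e \<subseteq> C" using D by simp
      qed
      then show False using no RS by (meson less_le_trans)
    qed
    then obtain f where f: "inj_on f S" "\<forall>s\<in>S. f s \<in> A s"
      using hall[of S A] fin(1,2) unfolding A_def by auto
    have "f ` S = P"
      using f fin SP unfolding A_def by (intro card_subset_eq) (auto simp: card_image)
    have "\<forall>s\<in>S. \<exists>c. c \<in> f s \<and> {s, c} \<in> E" using f(2) unfolding A_def by auto
    from bchoice[OF this] obtain g where g: "g s \<in> f s" "{s, g s} \<in> E" if "s \<in> S" for s
      by blast
    have fP: "f s \<in> P" if "s \<in> S" for s using that \<open>f ` S = P\<close> by auto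
    have "\<forall>s\<in>S. \<exists>N. perfect_matching (f s - {g s}) E N" using crit g fP by auto
    from bchoice[OF this] obtain N where N: "perfect_matching (f s - {g s}) E (N s)" if "s \<in> S" for s
      by blast
    \<comment> \<open>\<open>K s\<close> perfectly matches \<open>s\<close> together with its
      assigned part: \<open>s\<close> takes \<open>g s\<close>, and factor-criticality matches the
      rest of the part. These blocks partition \<open>X\<close>.\<close>
    define K where "K s = insert {s, g s} (N s)" for s
    have UK: "\<Union>(K s) = insert s (f s)" if "s \<in> S" for s
      using N[OF that] g[OF that] unfolding K_def perfect_matching_def by auto
    have dK: "disjoint (K s)" if "s \<in> S" for s
      unfolding K_def
    proof (rule disjoint_insertI)
      show "disjoint (N s)" using N[OF that] unfolding perfect_matching_def matching_def by auto
      fix e assume "e \<in> N s"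
      then have "e \<subseteq> f s - {g s}" using N[OF that] unfolding perfect_matching_def by auto
      then show "{s, g s} \<inter> e = {}" using B(6)[OF fP[OF that]] that by auto
    qed
    have dd: "insert s (f s) \<inter> insert t (f t) = {}" if "s \<in> S" "t \<in> S" "s \<noteq> t" for s t
    proof -
      have "f s \<noteq> f t" using f that unfolding inj_on_def by blast
      then have "f s \<inter> f t = {}"
        using fP that B(7) by auto
      then show ?thesis using B(6)[OF fP[OF that(1)]] B(6)[OF fP[OF that(2)]] that by auto
    qed
    have "perfect_matching X E (\<Union>s\<in>S. K s)"
      unfolding perfect_matching_def matching_def
    proof (intro conjI)
      show "(\<Union>s\<in>S. K s) \<subseteq> E" using N g unfolding K_def perfect_matching_def matching_def by blast
      have "\<Union>(\<Union>s\<in>S. K s) = (\<Union>s\<in>S. \<Union>(K s))" by blast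
      also have "\<dots> = (\<Union>s\<in>S. insert s (f s))" using UK by simp
      also have "\<dots> = S \<union> \<Union>(f ` S)" by blast
      also have "\<dots> = X" using B(1,2) \<open>f ` S = P\<close> by blast
      finally show "\<Union>(\<Union>s\<in>S. K s) = X" .
      show "disjoint (\<Union>s\<in>S. K s)"
      proof (rule disjointI)
        fix a b assume ab: "a \<in> (\<Union>s\<in>S. K s)" "b \<in> (\<Union>s\<in>S. K s)" "a \<noteq> b"
        then obtain s t where st: "s \<in> S" "t \<in> S" "a \<in> K s" "b \<in> K t" by blast
        show "a \<inter> b = {}"
        proof (cases "s = t")
          case True then show ?thesis using disjointD[OF dK[OF st(1)] st(3)] st(4) ab(3) by auto
        next
          case False
          have "a \<subseteq> insert s (f s)" "b \<subseteq> insert t (f t)"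
            using UK[OF st(1)] UK[OF st(2)] st(3,4) by blast+
          then show ?thesis using dd[OF st(1,2) False] by fast
        qed
      qed
    qed
    then show False using less.prems(2) by blast
  qed
qed

section \<open>Cycles and edge cuts\<close>

lemma walk_edges_subset: "e \<in> set (walk_edges p) \<Longrightarrow> e \<subseteq> set p"
  by (induction p rule: walk_edges.induct) auto

lemma is_cycle_mono: "is_cycle X E c \<Longrightarrow> X \<subseteq> V \<Longrightarrow> is_cycle V E c"
  unfolding is_cycle_def by auto

lemma walk_edges_map_upt:
  assumes "i \<le> j"
  shows "walk_edges (map f [i..<Suc j]) = map (\<lambda>k. {f k, f (Suc k)}) [i..<j]"
  using assms
proof (induction i rule: inc_induct)
  case base
  show ?case by simp
next
  case (step i)
  have "[i..<Suc j] = i # Suc i # [Suc (Suc i)..<Suc j]" "[i..<j] = i # [Suc i..<j]"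
    "[Suc i..<Suc j] = Suc i # [Suc (Suc i)..<Suc j]"
    using step.hyps by (simp_all add: upt_conv_Cons del: upt_Suc)
  then show ?case using step.IH by (simp del: upt_Suc)
qed

text \<open>Injectivity is asked on \<open>{i<..j}\<close> only, because a listed cycle repeats its
  first vertex at the end.\<close>

lemma is_cycle_map_upt:
  fixes f :: "nat \<Rightarrow> 'a"
  assumes "f i = f j" and "i + 3 \<le> j" and "inj_on f {i<..j}"
    and "\<And>k. i \<le> k \<Longrightarrow> k < j \<Longrightarrow> {f k, f (Suc k)} \<in> E"
    and "\<And>k. i \<le> k \<Longrightarrow> k \<le> j \<Longrightarrow> f k \<in> X"
  shows "is_cycle X E (map f [i..<Suc j])"
    and "length (walk_edges (map f [i..<Suc j])) = j - i"
proof -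
  have w: "walk_edges (map f [i..<Suc j]) = map (\<lambda>k. {f k, f (Suc k)}) [i..<j]"
    using assms(2) by (intro walk_edges_map_upt) simp
  then show "length (walk_edges (map f [i..<Suc j])) = j - i" by simp
  have "tl (map f [i..<Suc j]) = map f [Suc i..<Suc j]"
    using assms(2) by (simp add: upt_conv_Cons del: upt_Suc)
  moreover have "{Suc i..<Suc j} = {i<..j}" by auto
  ultimately have "distinct (tl (map f [i..<Suc j]))"
    using assms(3) by (simp add: distinct_map del: upt_Suc)
  then show "is_cycle X E (map f [i..<Suc j])"
    unfolding is_cycle_def w using assms(1,2,4,5)
    by (auto simp: hd_map last_map simp del: upt_Suc)
qed

section \<open>Odd closed walks, bipartitions and forests\<close>

text \<open>A closed walk without inner repetition is a cycle. A repetition splits it into two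
  shorter closed walks whose lengths add up to an odd number, so one of them is odd.\<close>

lemma odd_closed_walk_imp_odd_cycle:
  assumes "\<And>e. e \<in> E \<Longrightarrow> card e = 2"
    and "(x, x) \<in> {(x, y). x \<in> X \<and> y \<in> X \<and> {x, y} \<in> E} ^^ n" and "odd n"
  shows "\<exists>c. is_cycle X E c \<and> odd (length (walk_edges c))"
  using assms(2,3)
proof (induction n arbitrary: x rule: less_induct)
  case (less n)
  define R where "R = {(x, y). x \<in> X \<and> y \<in> X \<and> {x, y} \<in> E}"
  have "(x, x) \<in> R ^^ n" using less.prems unfolding R_def by simp
  then obtain f where f: "f 0 = x" "f n = x" "\<And>i. i < n \<Longrightarrow> (f i, f (Suc i)) \<in> R"
    unfolding relpow_fun_conv by blast
  have walk: "(f a, f b) \<in> R ^^ (b - a)" if "a \<le> b" "b \<le> n" for a b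
    unfolding relpow_fun_conv using that f(3) by (intro exI[of _ "\<lambda>k. f (a + k)"]) auto
  show ?case
  proof (cases "inj_on f {0<..n}")
    case True
    \<comment> \<open>Length one would be a loop; an odd length is then at least three, as a cycle
      requires.\<close>
    have "n \<noteq> 1"
    proof
      assume "n = 1"
      then have "{x} \<in> E" using f unfolding R_def by auto
      then show False using assms(1) by force
    qed
    then have n: "0 + 3 \<le> n" using less.prems(2) by presburger
    have X: "f k \<in> X" if "k \<le> n" for k
      using f(3)[of k] f(1,2) f(3)[of 0] n that unfolding R_def by (cases "k = n") auto
    have "f 0 = f n" using f by simp
    note * = is_cycle_map_upt[of f, OF this n True, of E X]
    have "is_cycle X E (map f [0..<Suc n])"
      using f(3) X unfolding R_def by (intro *(1)) auto
    moreover have "length (walk_edges (map f [0..<Suc n])) = n"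
      using f(3) X unfolding R_def by (subst *(2)) auto
    ultimately show ?thesis using less.prems(2) by metis
  next
    case False
    then obtain i j where ij: "0 < i" "i < j" "j \<le> n" "f i = f j"
      unfolding inj_on_def by (metis greaterThanAtMost_iff nat_neq_iff)
    have 1: "(f i, f i) \<in> R ^^ (j - i)" using walk[of i j] ij by simp
    have "(x, f i) \<in> R ^^ i" using walk[of 0 i] ij f by simp
    moreover have "(f i, x) \<in> R ^^ (n - j)" using walk[of j n] ij f by simp
    ultimately have 2: "(x, x) \<in> R ^^ (i + (n - j))" unfolding relpow_add by blast
    have "odd (j - i) \<or> odd (i + (n - j))" using less.prems(2) ij by presburger
    moreover have "j - i < n" "i + (n - j) < n" using ij by auto
    ultimately show ?thesis
      using less.IH[of "j - i" "f i"] less.IH[of "i + (n - j)" x] 1 2 unfolding R_def by blast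
  qed
qed

text \<open>Vertices are coloured by the parity of walks from a fixed representative of their
  component. All closed walks are even, so the parity does not depend on the walk.\<close>

lemma no_odd_cycle_imp_bipartite:
  assumes "\<And>e. e \<in> E \<Longrightarrow> card e = 2"
    and "\<nexists>c. is_cycle X E c \<and> odd (length (walk_edges c))"
  shows "\<exists>Y\<subseteq>X. \<forall>x\<in>X. \<forall>y\<in>X. {x, y} \<in> E \<longrightarrow> (x \<in> Y) \<noteq> (y \<in> Y)"
proof -
  define R where "R = {(x, y). x \<in> X \<and> y \<in> X \<and> {x, y} \<in> E}"
  have even_closed: "even n" if "(x, x) \<in> R ^^ n" for x n
    using odd_closed_walk_imp_odd_cycle[OF assms(1)] assms(2) that unfolding R_def by blast
  have sym: "(y, x) \<in> R ^^ n" if "(x, y) \<in> R ^^ n" for x y n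
    using that
  proof (induction n arbitrary: y)
    case (Suc n)
    then obtain z where z: "(x, z) \<in> R ^^ n" "(z, y) \<in> R" by auto
    then have "(y, z) \<in> R" unfolding R_def by (auto simp: insert_commute)
    then show ?case using Suc.IH[OF z(1)] relpow_Suc_I2 by metis
  qed simp
  \<comment> \<open>Adjacent vertices of \<open>X\<close> are reachable from the same vertices, so
    \<open>SOME\<close> is applied to the same predicate and yields the same representative for
    both.\<close>
  define w where "w v = (SOME u. (u, v) \<in> R\<^sup>*)" for v
  have w: "(w v, v) \<in> R\<^sup>*" for v unfolding w_def by (rule someI[of _ v]) simp
  define Y where "Y = {v \<in> X. \<exists>n. even n \<and> (w v, v) \<in> R ^^ n}"
  have "(x \<in> Y) \<noteq> (y \<in> Y)" if xy: "x \<in> X" "y \<in> X" "{x, y} \<in> E" for x y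
  proof -
    have R: "(x, y) \<in> R" "(y, x) \<in> R" using xy unfolding R_def by (auto simp: insert_commute)
    have "(\<lambda>u. (u, x) \<in> R\<^sup>*) = (\<lambda>u. (u, y) \<in> R\<^sup>*)"
      using R by (auto intro: rtrancl_into_rtrancl)
    then have eq: "w x = w y" unfolding w_def by simp
    show ?thesis
    proof (cases "x \<in> Y")
      case True
      then obtain a where a: "even a" "(w x, x) \<in> R ^^ a" unfolding Y_def by blast
      have "y \<notin> Y"
      proof
        assume "y \<in> Y"
        then obtain b where b: "even b" "(w x, y) \<in> R ^^ b" unfolding Y_def using eq by auto
        have "(y, x) \<in> R ^^ (b + a)" using sym[OF b(2)] a(2) unfolding relpow_add by blast
        then have "(x, x) \<in> R ^^ Suc (b + a)" using R(1) relpow_Suc_I2 by metis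
        then show False using even_closed a b by fastforce
      qed
      then show ?thesis using True by simp
    next
      case False
      obtain n where n: "(w x, x) \<in> R ^^ n" using w[of x] rtrancl_imp_relpow by metis
      then have "odd n" using False xy unfolding Y_def by blast
      moreover have "(w y, y) \<in> R ^^ Suc n" using n R(1) eq by auto
      ultimately have "y \<in> Y" using xy unfolding Y_def by (metis (mono_tags, lifting) even_Suc mem_Collect_eq)
      then show ?thesis using False by simp
    qed
  qed
  then show ?thesis by (intro exI[of _ Y]) (auto simp: Y_def)
qed

text \<open>A walk that never turns straight back can go on forever in \<open>X\<close>; by
  finiteness it repeats a vertex, and a shortest repetition is a cycle.\<close>

lemma min_degree_imp_cycle:
  assumes "finite X" and "X \<noteq> {}" and "\<And>e. e \<in> E \<Longrightarrow> card e = 2"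
    and "\<And>p x. x \<in> X \<Longrightarrow> \<exists>y\<in>X. {x, y} \<in> E \<and> y \<noteq> p"
  shows "\<exists>c. is_cycle X E c"
proof -
  obtain x0 where x0: "x0 \<in> X" using assms(2) by blast
  obtain nxt where nxt: "nxt p x \<in> X" "{x, nxt p x} \<in> E" "nxt p x \<noteq> p" if "x \<in> X" for p x
  proof -
    have "\<forall>q\<in>UNIV \<times> X. \<exists>y. y \<in> X \<and> {snd q, y} \<in> E \<and> y \<noteq> fst q" using assms(4) by auto
    then obtain h where h: "\<And>q. q \<in> UNIV \<times> X \<Longrightarrow> h q \<in> X \<and> {snd q, h q} \<in> E \<and> h q \<noteq> fst q"
      by metis
    show ?thesis by (rule that[of "\<lambda>p x. h (p, x)"]) (use h in force)+
  qed
  \<comment> \<open>The state is the pair of the previous and the current vertex. At the start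
    \<open>x0\<close> also fills the place of the missing predecessor.\<close>
  define g where "g = rec_nat (x0, x0) (\<lambda>_ q. (snd q, nxt (fst q) (snd q)))"
  define f where "f n = snd (g n)" for n
  have g: "g 0 = (x0, x0)" "\<And>n. g (Suc n) = (f n, nxt (fst (g n)) (f n))"
    unfolding g_def f_def by simp_all
  have fX: "f n \<in> X" for n
    by (induction n) (use x0 nxt g in \<open>auto simp: f_def\<close>)
  have fE: "{f n, f (Suc n)} \<in> E" for n using nxt(2)[OF fX] g(2) unfolding f_def by auto
  have f2: "f (Suc (Suc n)) \<noteq> f n" for n
    using nxt(3)[OF fX, of "f n" "Suc n"] g(2)[of n] g(2)[of "Suc n"] by (auto simp: f_def)
  have f1: "f (Suc n) \<noteq> f n" for n
  proof
    assume "f (Suc n) = f n"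
    then have "{f n} \<in> E" using fE[of n] by simp
    then show False using assms(3) by force
  qed
  have "\<not> inj f" using assms(1) fX by (meson finite_imageD finite_subset image_subsetI infinite_UNIV_nat)
  then obtain i j where "i < j" "f i = f j" unfolding inj_def by (metis nat_neq_iff)
  then have ex: "\<exists>d. d > 0 \<and> (\<exists>i. f i = f (i + d))"
    by (intro exI[of _ "j - i"]) (auto intro: exI[of _ i])
  \<comment> \<open>The gap is minimized over all positions of the walk, so the vertices strictly
    after \<open>i\<close> up to \<open>i + d\<close> are distinct. Gaps one and two are excluded by
    \<open>f1\<close> and \<open>f2\<close>.\<close>
  define d where "d = (LEAST d. d > 0 \<and> (\<exists>i. f i = f (i + d)))"
  have d: "d > 0" "\<exists>i. f i = f (i + d)" using LeastI_ex[OF ex] unfolding d_def by auto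
  have least: "d \<le> d'" if "d' > 0" "f i = f (i + d')" for d' i
    unfolding d_def using that by (intro Least_le) blast
  obtain i where i: "f i = f (i + d)" using d by blast
  have "d \<noteq> 1" using i f1[of i] by auto
  moreover have "d \<noteq> 2" using i f2[of i] by (auto simp: numeral_2_eq_2)
  ultimately have d3: "i + 3 \<le> i + d" using d(1) by linarith
  have inj: "inj_on f {i<..i + d}"
  proof (rule linorder_inj_onI)
    fix a b assume ab: "a < b" "a \<in> {i<..i + d}" "b \<in> {i<..i + d}"
    show "f a \<noteq> f b"
    proof
      assume "f a = f b"
      then have "d \<le> b - a" using ab by (intro least[of _ a]) auto
      then show False using ab by auto
    qed
  qed auto
  show ?thesis using is_cycle_map_upt(1)[OF i d3 inj] fE fX by blast
qed

text \<open>Removing a vertex with at most one edge inside \<open>X\<close> preserves the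
  inequality. If there is no such vertex, all degrees inside \<open>X\<close> are at least
  two.\<close>

lemma many_edges_imp_cycle:
  assumes "finite X" and "X \<noteq> {}" and "\<And>e. e \<in> E \<Longrightarrow> card e = 2"
    and "card X \<le> card {e \<in> E. e \<subseteq> X}"
  shows "\<exists>c. is_cycle X E c"
  using assms(1,2,4)
proof (induction "card X" arbitrary: X rule: less_induct)
  case less
  have fin: "finite {e \<in> E. e \<subseteq> X}"
    by (rule finite_subset[of _ "Pow X"]) (use less.prems in auto)
  show ?case
  proof (cases "\<exists>x\<in>X. card {e \<in> E. e \<subseteq> X \<and> x \<in> e} \<le> 1")
    case True
    then obtain x where x: "x \<in> X" "card {e \<in> E. e \<subseteq> X \<and> x \<in> e} \<le> 1" by blast
    have eq: "{e \<in> E. e \<subseteq> X} = {e \<in> E. e \<subseteq> X - {x}} \<union> {e \<in> E. e \<subseteq> X \<and> x \<in> e}" by auto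
    have "card {e \<in> E. e \<subseteq> X} \<le> card {e \<in> E. e \<subseteq> X - {x}} + card {e \<in> E. e \<subseteq> X \<and> x \<in> e}"
      by (subst eq) (rule card_Un_le)
    moreover have cX: "card X = Suc (card (X - {x}))" by (rule card.remove[OF less.prems(1) x(1)])
    ultimately have le: "card (X - {x}) \<le> card {e \<in> E. e \<subseteq> X - {x}}"
      using x(2) less.prems(3) by linarith
    \<comment> \<open>A single vertex spans no edge, so the inequality fails before the removals
      could exhaust \<open>X\<close>.\<close>
    have "X - {x} \<noteq> {}"
    proof
      assume "X - {x} = {}"
      then have "X = {x}" using x(1) by auto
      moreover have "e \<notin> E" if "e \<subseteq> {x}" for e
        using assms(3)[of e] card_mono[OF _ that] by auto
      ultimately have "{e \<in> E. e \<subseteq> X} = {}" by blast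
      then have "card {e \<in> E. e \<subseteq> X} = 0" by (simp only: card.empty)
      then show False using less.prems(3) cX by linarith
    qed
    then obtain c where "is_cycle (X - {x}) E c"
      using less.hyps[of "X - {x}"] le cX less.prems(1) by auto
    then show ?thesis using is_cycle_mono by (metis Diff_subset)
  next
    case False
    show ?thesis
    proof (rule min_degree_imp_cycle[OF less.prems(1,2) assms(3)])
      fix p x assume x: "x \<in> X"
      let ?D = "{e \<in> E. e \<subseteq> X \<and> x \<in> e}"
      have "finite ?D" by (rule finite_subset[OF _ fin]) auto
      moreover have "\<not> card ?D \<le> 1" using False x by blast
      ultimately have "\<not> ?D \<subseteq> {{x, p}}" using card_mono[of "{{x, p}}" ?D] by auto
      then obtain e where e: "e \<in> E" "e \<subseteq> X" "x \<in> e" "e \<noteq> {x, p}" by blast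
      obtain y where "e = {x, y}" using assms(3)[OF e(1)] e(3)
        by (metis card_2_iff doubleton_eq_iff insertE singletonD)
      then show "\<exists>y\<in>X. {x, y} \<in> E \<and> y \<noteq> p" using e by auto
    qed
  qed
qed

section \<open>Boundaries, degree sums and cyclic edge cuts\<close>

definition boundary :: "'a set set \<Rightarrow> 'a set \<Rightarrow> 'a set set" where
  "boundary E X = {e \<in> E. card (e \<inter> X) = 1}"

definition inner_edges :: "'a set set \<Rightarrow> 'a set \<Rightarrow> 'a set set" where
  "inner_edges E X = {e \<in> E. e \<subseteq> X}"

text \<open>Incidences are counted by edges instead of vertices: an edge inside \<open>X\<close>
  counts twice, a boundary edge once.\<close>

lemma degree_sum:
  assumes "finite X" and "finite E" and "\<And>e. e \<in> E \<Longrightarrow> card e = 2"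
    and "\<And>x. x \<in> X \<Longrightarrow> card {e \<in> E. x \<in> e} = r"
  shows "r * card X = card (boundary E X) + 2 * card (inner_edges E X)"
proof -
  have "r * card X = (\<Sum>x\<in>X. card {e \<in> E. x \<in> e})" using assms(4) by simp
  also have "\<dots> = (\<Sum>x\<in>X. \<Sum>e\<in>E. if x \<in> e then 1 else 0)"
    using assms(2) by (simp add: sum.If_cases Int_def)
  also have "\<dots> = (\<Sum>e\<in>E. \<Sum>x\<in>X. if x \<in> e then 1 else 0)" by (rule sum.swap)
  also have "\<dots> = (\<Sum>e\<in>E. card (e \<inter> X))"
    using assms(1) by (simp add: sum.If_cases Int_def conj_commute)
  also have "\<dots> = (\<Sum>e\<in>E. (if e \<in> boundary E X then 1 else 0) + (if e \<in> inner_edges E X then 2 else 0))"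
  proof (rule sum.cong[OF refl])
    fix e assume e: "e \<in> E"
    then have fe: "finite e" "card e = 2" using assms(3) card.infinite by fastforce+
    then have "card (e \<inter> X) \<le> 2" using card_mono[of e "e \<inter> X"] by simp
    then consider "card (e \<inter> X) = 0" | "card (e \<inter> X) = 1" | "card (e \<inter> X) = 2" by linarith
    moreover have "e \<subseteq> X \<longleftrightarrow> card (e \<inter> X) = 2"
      using fe card_subset_eq[of e "e \<inter> X"] by (auto simp: Int_absorb2)
    ultimately show "card (e \<inter> X) = (if e \<in> boundary E X then 1 else 0) + (if e \<in> inner_edges E X then 2 else 0)"
      using e unfolding boundary_def inner_edges_def by cases auto
  qed
  also have "\<dots> = card (boundary E X) + 2 * card (inner_edges E X)"
    using assms(2) unfolding sum.distrib
    by (simp add: sum.If_cases Int_def boundary_def inner_edges_def conj_ac)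
  finally show ?thesis .
qed

lemma walk_reachable:
  assumes "set (walk_edges p) \<subseteq> F" and "v \<in> set p"
  shows "(hd p, v) \<in> {(x, y). {x, y} \<in> F}\<^sup>*"
  using assms
proof (induction p rule: walk_edges.induct)
  case (1 a b p)
  show ?case
  proof (cases "v = a")
    case False
    then have "(b, v) \<in> {(x, y). {x, y} \<in> F}\<^sup>*" using 1 by auto
    moreover have "(a, b) \<in> {(x, y). {x, y} \<in> F}" using 1 by auto
    ultimately show ?thesis by (simp add: converse_rtrancl_into_rtrancl)
  qed simp
qed auto

lemma is_cycle_nonempty: "is_cycle V E c \<Longrightarrow> c \<noteq> []"
  unfolding is_cycle_def by auto

text \<open>Without its boundary, \<open>C\<close> cannot be left, so the two cycles lie in
  different components. Connectedness of \<open>C\<close> or its complement is not assumed.\<close>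

lemma boundary_cyclic_edge_cut:
  assumes "\<And>e. e \<in> E \<Longrightarrow> card e = 2" and "C \<subseteq> V"
    and c: "is_cycle C E c" and d: "is_cycle (V - C) E d"
  shows "cyclic_edge_cut V E (boundary E C)"
    and "odd (length (walk_edges c)) \<Longrightarrow> odd_cyclic_edge_cut V E (boundary E C)"
proof -
  let ?F = "E - boundary E C"
  let ?K = "\<lambda>v. {u \<in> V. (v, u) \<in> {(x, y). {x, y} \<in> ?F}\<^sup>*}"
  have ne: "c \<noteq> []" "d \<noteq> []" using c d is_cycle_nonempty by auto
  have cF: "set (walk_edges c) \<subseteq> ?F"
  proof
    fix e assume e: "e \<in> set (walk_edges c)"
    then have "e \<subseteq> C" "e \<in> E" using walk_edges_subset c unfolding is_cycle_def by blast+
    then show "e \<in> ?F" using assms(1) unfolding boundary_def by (auto simp: Int_absorb2)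
  qed
  have dF: "set (walk_edges d) \<subseteq> ?F"
  proof
    fix e assume e: "e \<in> set (walk_edges d)"
    then have "e \<subseteq> V - C" "e \<in> E" using walk_edges_subset d unfolding is_cycle_def by blast+
    then have "e \<inter> C = {}" by auto
    then show "e \<in> ?F" using \<open>e \<in> E\<close> unfolding boundary_def by auto
  qed
  have cV: "set c \<subseteq> C" and dV: "set d \<subseteq> V - C" using c d unfolding is_cycle_def by auto
  have cyc: "is_cycle V ?F c" "is_cycle V ?F d"
    using c d cF dF assms(2) unfolding is_cycle_def by auto
  have sub: "set c \<subseteq> ?K (hd c)" "set d \<subseteq> ?K (hd d)"
    using walk_reachable[OF cF] walk_reachable[OF dF] cV dV assms(2) by auto
  have "u \<in> C" if "(hd c, u) \<in> {(x, y). {x, y} \<in> ?F}\<^sup>*" for u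
    using that
  proof induction
    case base
    then show ?case using cV ne by auto
  next
    case (step y z)
    show ?case
    proof (rule ccontr)
      assume "z \<notin> C"
      then have "{y, z} \<inter> C = {y}" using step.IH by auto
      then show False using step.hyps(2) unfolding boundary_def by auto
    qed
  qed
  then have "hd d \<notin> ?K (hd c)" using dV ne hd_in_set by fastforce
  moreover have "hd d \<in> ?K (hd d)" using sub(2) ne hd_in_set by blast
  ultimately have neq: "?K (hd c) \<noteq> ?K (hd d)" by blast
  have comp: "?K (hd c) \<in> components V ?F" "?K (hd d) \<in> components V ?F"
    unfolding components_def using cV dV ne assms(2) hd_in_set[of c] hd_in_set[of d] by blast+
  show cut: "cyclic_edge_cut V E (boundary E C)"
    unfolding cyclic_edge_cut_def
  proof (intro conjI)
    show "boundary E C \<subseteq> E" by (auto simp: boundary_def)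
    show "\<exists>C'\<in>components V ?F. \<exists>D\<in>components V ?F. C' \<noteq> D \<and>
        (\<exists>c. is_cycle V ?F c \<and> set c \<subseteq> C') \<and> (\<exists>d. is_cycle V ?F d \<and> set d \<subseteq> D)"
      by (rule bexI[OF _ comp(1)], rule bexI[OF _ comp(2)]) (use neq sub cyc in blast)
  qed
  show "odd_cyclic_edge_cut V E (boundary E C)" if "odd (length (walk_edges c))"
    unfolding odd_cyclic_edge_cut_def using cut comp(1) cyc(1) sub(1) that by blast
qed

section \<open>Odd ears and barriers\<close>

lemma distinct_walk_edges: "distinct p \<Longrightarrow> distinct (walk_edges p)"
  by (induction p rule: walk_edges.induct) (auto dest: walk_edges_subset)

text \<open>The tail is a path. The first edge \<open>{u, v}\<close> contains \<open>u\<close>,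
  which recurs only at the end, so it could only equal \<open>{v, w}\<close>; having at least three
  edges rules that out.\<close>

lemma is_cycle_distinct_walk_edges:
  assumes "is_cycle V E c"
  shows "distinct (walk_edges c)"
proof -
  obtain u v w q where c: "c = u # v # w # q"
    using assms unfolding is_cycle_def
    by (metis (no_types, opaque_lifting) One_nat_def Suc_le_mono le_zero_eq list.size(3,4)
        nat.distinct(1) numeral_3_eq_3 walk_edges.simps plus_1_eq_Suc add.commute list.exhaust)
  have d: "distinct (v # w # q)" and l: "u = last (w # q)" and q: "q \<noteq> []"
    using assms unfolding is_cycle_def c by auto
  have "u \<noteq> w" using l d q by auto
  moreover have "u \<noteq> v" using l d last_in_set[of "w # q"] by auto
  ultimately have "{u, v} \<noteq> {v, w}" by (auto simp: doubleton_eq_iff)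
  moreover have "{u, v} \<notin> set (walk_edges (w # q))"
    using walk_edges_subset[of "{u, v}" "w # q"] d by auto
  ultimately show ?thesis using distinct_walk_edges[OF d] unfolding c by simp
qed

text \<open>\<open>A\<close> is meant to be the matched vertices with the separating set, and
  \<open>N\<close> the union of the nontrivial parts. Edges at singleton parts get weight
  zero.\<close>

definition ear_weight :: "'a set \<Rightarrow> 'a set \<Rightarrow> 'a set \<Rightarrow> nat" where
  "ear_weight A N e = (if e \<subseteq> A then 2 else if e \<inter> A \<noteq> {} \<and> e \<inter> N \<noteq> {} then 1 else 0)"

text \<open>The weight changes parity exactly when the walk crosses between \<open>A\<close> and
  \<open>N\<close>. A walk of weight zero stays in \<open>N\<close> or alternates between
  \<open>A\<close> and \<open>Z\<close>, and then its ends determine the parity of its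
  length.\<close>

lemma walk_weight_parity:
  assumes "A \<inter> N = {}" and "Z \<inter> (A \<union> N) = {}"
    and "\<And>x y. {x, y} \<in> E \<Longrightarrow> x \<in> Z \<Longrightarrow> y \<in> A"
    and "p \<noteq> []" and "set p \<subseteq> A \<union> N \<union> Z" and "set (walk_edges p) \<subseteq> E"
  defines "W q \<equiv> sum_list (map (ear_weight A N) (walk_edges q))"
  shows "(even (W p) \<longleftrightarrow> (hd p \<in> N \<longleftrightarrow> last p \<in> N)) \<and>
    (W p = 0 \<longrightarrow> set p \<subseteq> N \<or>
      set p \<inter> N = {} \<and> (even (length (walk_edges p)) \<longleftrightarrow> (hd p \<in> Z \<longleftrightarrow> last p \<in> Z)))"
  using assms(4-6)
proof (induction p rule: walk_edges.induct)
  case (1 a b p)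
  have e: "{a, b} \<in> E" "{b, a} \<in> E" using "1.prems" by (auto simp: insert_commute)
  have ab: "a \<in> A \<union> N \<union> Z" "b \<in> A \<union> N \<union> Z" using "1.prems" by auto
  have W: "W (a # b # p) = ear_weight A N {a, b} + W (b # p)" unfolding W_def by simp
  have IH: "(even (W (b # p)) \<longleftrightarrow> (b \<in> N \<longleftrightarrow> last (b # p) \<in> N)) \<and>
    (W (b # p) = 0 \<longrightarrow> set (b # p) \<subseteq> N \<or>
      set (b # p) \<inter> N = {} \<and> (even (length (walk_edges (b # p))) \<longleftrightarrow> (b \<in> Z \<longleftrightarrow> last (b # p) \<in> Z)))"
    using 1 by simp
  have len: "length (walk_edges (a # b # p)) = Suc (length (walk_edges (b # p)))"
    "last (a # b # p) = last (b # p)" "hd (a # b # p) = a" "set (a # b # p) = insert a (set (b # p))"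
    by simp_all
  have bp: "b \<in> set (b # p)" by simp
  have nZ: "x \<notin> Z" if "x \<in> A \<or> x \<in> N" for x using that assms(2) by auto
  have nN: "x \<notin> N" if "x \<in> A \<or> x \<in> Z" for x using that assms(1,2) by auto
  have nA: "x \<notin> A" if "x \<in> N \<or> x \<in> Z" for x using that assms(1,2) by auto
  \<comment> \<open>Every edge at \<open>Z\<close> has its other end in \<open>A\<close>, which
    leaves six of the nine combinations.\<close>
  consider (AA) "a \<in> A" "b \<in> A" | (AN) "a \<in> A" "b \<in> N" | (NA) "a \<in> N" "b \<in> A"
    | (NN) "a \<in> N" "b \<in> N" | (AZ) "a \<in> A" "b \<in> Z" | (ZA) "a \<in> Z" "b \<in> A"
    using assms(3)[OF e(1)] assms(3)[OF e(2)] ab nA by blast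
  then show ?case
  proof cases
    case AA
    then have "ear_weight A N {a, b} = 2" unfolding ear_weight_def by auto
    then show ?thesis unfolding W len using IH AA nN by simp
  next
    case AN
    then have "ear_weight A N {a, b} = 1" unfolding ear_weight_def using nA by auto
    then show ?thesis unfolding W len using IH AN nN by simp
  next
    case NA
    then have "ear_weight A N {a, b} = 1" unfolding ear_weight_def using nA by auto
    then show ?thesis unfolding W len using IH NA nN by simp
  next
    case NN
    then have "ear_weight A N {a, b} = 0" unfolding ear_weight_def using nA by auto
    then show ?thesis unfolding W len using IH NN bp by auto
  next
    case AZ
    then have "ear_weight A N {a, b} = 0" unfolding ear_weight_def using nN nA by auto
    then show ?thesis unfolding W len using IH AZ bp nN nZ by auto
  next
    case ZA
    then have "ear_weight A N {a, b} = 0" unfolding ear_weight_def using nN nA by auto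
    then show ?thesis unfolding W len using IH ZA bp nN nZ by auto
  qed
qed (auto simp: W_def)

text \<open>The ends make the weight even. Weight zero is impossible: the ear meets
  \<open>U\<close>, so it is not inside \<open>N\<close>, and an alternating walk with such ends has
  even length.\<close>

lemma odd_ear_weight:
  assumes "A \<inter> N = {}" and "Z \<inter> (A \<union> N) = {}" and "V = A \<union> N \<union> Z" and "U \<subseteq> A"
    and "\<And>x y. {x, y} \<in> E \<Longrightarrow> x \<in> Z \<Longrightarrow> y \<in> A"
    and "odd_ear V E U p"
  shows "2 \<le> sum (ear_weight A N) (set (walk_edges p))"
proof -
  define W where "W = sum_list (map (ear_weight A N) (walk_edges p))"
  have ear: "(is_path V E p \<and> hd p \<in> U \<and> last p \<in> U) \<or> (is_cycle V E p \<and> card (set p \<inter> U) = 1)"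
    and odd: "odd (length (walk_edges p))"
    using assms(6) unfolding odd_ear_def ear_def by auto
  have p: "p \<noteq> []" "set p \<subseteq> V" "set (walk_edges p) \<subseteq> E"
    using ear unfolding is_path_def is_cycle_def by auto
  have "distinct (walk_edges p)"
    using ear distinct_walk_edges is_cycle_distinct_walk_edges unfolding is_path_def by auto
  then have W: "W = sum (ear_weight A N) (set (walk_edges p))"
    unfolding W_def by (rule sum_list_distinct_conv_sum_set)
  have par: "(even W \<longleftrightarrow> (hd p \<in> N \<longleftrightarrow> last p \<in> N)) \<and>
    (W = 0 \<longrightarrow> set p \<subseteq> N \<or>
      set p \<inter> N = {} \<and> (even (length (walk_edges p)) \<longleftrightarrow> (hd p \<in> Z \<longleftrightarrow> last p \<in> Z)))"
    unfolding W_def using p assms(3) by (intro walk_weight_parity[OF assms(1,2,5)]) auto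
  \<comment> \<open>The listed start of a cycle need not be its vertex in \<open>U\<close>; it
    suffices that start and end coincide.\<close>
  have ends: "(hd p \<in> N \<longleftrightarrow> last p \<in> N) \<and> (hd p \<in> Z \<longleftrightarrow> last p \<in> Z)"
    using ear assms(1,2,4) unfolding is_cycle_def by auto
  have "set p \<inter> U \<noteq> {}"
    using ear p(1) hd_in_set[of p] by fastforce
  then have "\<not> set p \<subseteq> N" using assms(1,4) by blast
  then have "W \<noteq> 0" "even W" using par ends odd by auto
  then show ?thesis using W by presburger
qed

text \<open>A bipartite part of odd order could be refined: move its smaller colour class to \<open>S\<close> and split
  the larger one into singletons.\<close>

lemma barrier_part_odd_cycle:
  assumes "finite X" and "\<And>e. e \<in> E \<Longrightarrow> card e = 2"
    and b: "barrier E X S P" and SP: "card S < card P"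
    and max: "\<And>S' P'. barrier E X S' P' \<Longrightarrow> card S' < card P' \<Longrightarrow> card P' \<le> card P"
    and C: "C \<in> P" "card C \<noteq> 1"
  shows "\<exists>c. is_cycle C E c \<and> odd (length (walk_edges c))"
proof (rule ccontr)
  assume no: "\<not> ?thesis"
  have fC: "finite C" using barrier_finite(3)[OF b assms(1) C(1)] .
  have oC: "odd (card C)" using barrierD(5)[OF b C(1)] .
  obtain Y where Y: "Y \<subseteq> C" "\<forall>x\<in>C. \<forall>y\<in>C. {x, y} \<in> E \<longrightarrow> (x \<in> Y) \<noteq> (y \<in> Y)"
    using no_odd_cycle_imp_bipartite[OF assms(2), of E C] no by blast
  have contra: False if T: "T \<subseteq> C" "card T < card (C - T)"
    "\<forall>x\<in>C. \<forall>y\<in>C. {x, y} \<in> E \<longrightarrow> (x \<in> T) \<noteq> (y \<in> T)" for T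
  proof -
    let ?Q = "(\<lambda>x. {x}) ` (C - T)"
    have b': "barrier E C T ?Q"
    proof (rule barrierI)
      show "disjoint ?Q" by (auto simp: disjoint_def)
      fix e assume e: "e \<in> E" "e \<subseteq> C - T"
      obtain x y where xy: "e = {x, y}" using assms(2)[OF e(1)] by (auto simp: card_2_iff)
      then have "x \<in> C - T" "y \<in> C - T" "{x, y} \<in> E" using e by auto
      then show "\<exists>D\<in>?Q. e \<subseteq> D" using T(3) by blast
    qed (use T(1) in auto)
    note ref = barrier_refine[OF assms(1) b C(1) b']
    have cQ: "card ?Q = card (C - T)" by (rule card_image) auto
    have "card C = card T + card (C - T)"
      using T(1) fC by (metis card_Diff_subset card_mono finite_subset le_add_diff_inverse)
    \<comment> \<open>Refining adds \<open>card (C - T) - 1\<close> parts, so two singletons are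
      needed for a strict increase.\<close>
    then have "2 \<le> card (C - T)" using T(2) C(2) oC by (cases "card T") auto
    then have "card P < card (P - {C} \<union> ?Q)" "card (S \<union> T) < card (P - {C} \<union> ?Q)"
      using ref(2,3) cQ T(2) SP by linarith+
    then show False using max[OF ref(1)] by linarith
  qed
  have cY: "card C = card Y + card (C - Y)"
    using Y(1) fC by (metis card_Diff_subset card_mono finite_subset le_add_diff_inverse)
  then have "card Y < card (C - Y) \<or> card (C - Y) < card Y" using oC by presburger
  then show False
  proof
    assume "card (C - Y) < card Y"
    moreover have "C - (C - Y) = Y" using Y(1) by blast
    ultimately show False using contra[of "C - Y"] Y(2) by auto
  qed (use contra[of Y] Y in blast)
qed

section \<open>Edge counts around a barrier in a regular graph\<close>

locale regular_barrier =
  fixes V :: "'a set" and E :: "'a set set" and r :: nat and U S :: "'a set" and P :: "'a set set"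
  assumes simple: "simple_graph V E" and regular: "regular V E r"
    and UV: "U \<subseteq> V" and barrier: "barrier E (V - U) S P"
begin

abbreviation "A \<equiv> U \<union> S"

abbreviation "d C \<equiv> card (boundary E C)"

lemma finV: "finite V" and edge_card: "e \<in> E \<Longrightarrow> card e = 2" and edge_subset: "e \<in> E \<Longrightarrow> e \<subseteq> V"
  using simple unfolding simple_graph_def by auto

lemma finE: "finite E"
  using finV edge_subset by (intro finite_subset[of E "Pow V"]) auto

lemma finP: "finite P" and finA: "finite A"
  using barrier_finite[OF barrier] finV UV by (auto intro: finite_subset)

lemma SV: "S \<subseteq> V - U" and UnionP: "\<Union>P = V - A" and part_subset: "C \<in> P \<Longrightarrow> C \<subseteq> V - A"
  using barrierD(1,2,6)[OF barrier] by auto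

lemma edgeE:
  assumes "e \<in> E"
  obtains x y where "e = {x, y}" "x \<noteq> y" "x \<in> V" "y \<in> V"
  using edge_card[OF assms] edge_subset[OF assms] by (auto simp: card_2_iff)

lemma parts_disjoint: "C \<in> P \<Longrightarrow> D \<in> P \<Longrightarrow> x \<in> C \<Longrightarrow> x \<in> D \<Longrightarrow> C = D"
  using barrierD(7)[OF barrier] by blast

lemma edge_in_part:
  assumes "{x, y} \<in> E" and "x \<notin> A" and "y \<notin> A" and "C \<in> P" and "x \<in> C"
  shows "y \<in> C"
proof -
  have "{x, y} \<subseteq> V - U - S" using assms edge_subset by blast
  then obtain D where "D \<in> P" "{x, y} \<subseteq> D" using barrierD(8)[OF barrier assms(1)] by blast
  then show ?thesis using parts_disjoint[of C D x] assms by auto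
qed

text \<open>No edge joins two different parts, so every edge leaving a part ends in
  \<open>A\<close>.\<close>

lemma boundary_part:
  assumes "C \<in> P"
  shows "boundary E C = {e \<in> E. e \<inter> A \<noteq> {} \<and> e \<inter> C \<noteq> {}}"
proof -
  have "card (e \<inter> C) = 1 \<longleftrightarrow> e \<inter> A \<noteq> {} \<and> e \<inter> C \<noteq> {}" if e: "e \<in> E" for e
  proof -
    obtain x y where xy: "e = {x, y}" "x \<noteq> y" "x \<in> V" "y \<in> V" using edgeE[OF e] .
    have CA: "z \<notin> A" if "z \<in> C" for z using part_subset[OF assms] that by auto
    have "x \<in> C \<longleftrightarrow> y \<in> C" if "x \<notin> A" "y \<notin> A"
      using edge_in_part[of x y C] edge_in_part[of y x C] that e assms unfolding xy(1)
      by (auto simp: insert_commute)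
    moreover have "card (e \<inter> C) = 1 \<longleftrightarrow> (x \<in> C) \<noteq> (y \<in> C)"
      using xy(2) unfolding xy(1) by (simp add: Int_insert_left)
    moreover have "e \<inter> A \<noteq> {} \<longleftrightarrow> x \<in> A \<or> y \<in> A" "e \<inter> C \<noteq> {} \<longleftrightarrow> x \<in> C \<or> y \<in> C"
      unfolding xy(1) by auto
    ultimately show ?thesis
      using CA[of x] CA[of y] by blast
  qed
  then show ?thesis unfolding boundary_def by auto
qed

lemma card_edges_to_parts:
  assumes "Q \<subseteq> P"
  shows "card {e \<in> E. e \<inter> A \<noteq> {} \<and> e \<inter> \<Union>Q \<noteq> {}} = (\<Sum>C\<in>Q. d C)"
proof -
  have "(\<Union>C\<in>Q. boundary E C) = (\<Union>C\<in>Q. {e \<in> E. e \<inter> A \<noteq> {} \<and> e \<inter> C \<noteq> {}})"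
    using assms by (intro SUP_cong boundary_part) auto
  then have eq: "{e \<in> E. e \<inter> A \<noteq> {} \<and> e \<inter> \<Union>Q \<noteq> {}} = (\<Union>C\<in>Q. boundary E C)"
    by blast
  show ?thesis unfolding eq
  proof (rule card_UN_disjoint)
    show "finite Q" using finP assms finite_subset by blast
    show "\<forall>C\<in>Q. finite (boundary E C)" using finE unfolding boundary_def by auto
    show "\<forall>C\<in>Q. \<forall>D\<in>Q. C \<noteq> D \<longrightarrow> boundary E C \<inter> boundary E D = {}"
    proof (intro ballI impI, rule ccontr)
      fix C D assume CD: "C \<in> Q" "D \<in> Q" "C \<noteq> D" "boundary E C \<inter> boundary E D \<noteq> {}"
      have P: "C \<in> P" "D \<in> P" using CD assms by auto
      obtain e where e: "e \<in> E" "e \<inter> A \<noteq> {}" "e \<inter> C \<noteq> {}" "e \<inter> D \<noteq> {}"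
        using CD(4) boundary_part[OF P(1)] boundary_part[OF P(2)] by auto
      have "C \<inter> A = {}" "D \<inter> A = {}" "C \<inter> D = {}"
        using part_subset P barrierD(7)[OF barrier P CD(3)] by auto
      moreover obtain x y where "e = {x, y}" using edgeE[OF e(1)] .
      ultimately show False using e(2-4) by auto
    qed
  qed
qed

lemma boundary_A: "d A = (\<Sum>C\<in>P. d C)"
proof -
  have "card (e \<inter> A) = 1 \<longleftrightarrow> e \<inter> A \<noteq> {} \<and> e \<inter> \<Union>P \<noteq> {}" if e: "e \<in> E" for e
  proof -
    obtain x y where xy: "e = {x, y}" "x \<noteq> y" "x \<in> V" "y \<in> V" using edgeE[OF e] .
    have "e \<inter> A = (if x \<in> A then {x} else {}) \<union> (if y \<in> A then {y} else {})"
      unfolding xy(1) by auto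
    then show ?thesis using xy UnionP by auto
  qed
  then have "boundary E A = {e \<in> E. e \<inter> A \<noteq> {} \<and> e \<inter> \<Union>P \<noteq> {}}" unfolding boundary_def by auto
  then show ?thesis using card_edges_to_parts[of P] by simp
qed

lemma degree_sum_subset:
  assumes "X \<subseteq> V"
  shows "r * card X = d X + 2 * card (inner_edges E X)"
  using assms finV finE edge_card regular unfolding regular_def
  by (intro degree_sum) (auto intro: finite_subset)

lemma degree_sum_A: "r * card A = (\<Sum>C\<in>P. d C) + 2 * card (inner_edges E A)"
  using degree_sum_subset[of A] boundary_A UV SV by auto

text \<open>The degree sum \<open>r * card C\<close> has the parity of \<open>r\<close> because
  \<open>card C\<close> is odd, and inner edges contribute an even amount.\<close>

lemma part_boundary_parity: "C \<in> P \<Longrightarrow> even (d C) \<longleftrightarrow> even r"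
  using degree_sum_subset[of C] part_subset[of C] barrierD(5)[OF barrier, of C]
  by (metis Diff_subset even_add even_mult_iff even_numeral subset_trans)

lemma singleton_boundary:
  assumes "C \<in> P" and "card C = 1"
  shows "d C = r"
proof -
  have "e \<notin> E" if "e \<subseteq> C" for e
    using edge_card[of e] card_mono[of C e] that assms(2) card_ge_0_finite[of C] by fastforce
  then have "inner_edges E C = {}" unfolding inner_edges_def by blast
  then show ?thesis using degree_sum_subset[of C] part_subset[OF assms(1)] assms(2) by auto
qed

definition "singles = {C \<in> P. card C = 1}"

definition "nontrivial = {C \<in> P. card C \<noteq> 1}"

lemma sum_boundary_split: "(\<Sum>C\<in>P. d C) = r * card singles + (\<Sum>C\<in>nontrivial. d C)"
proof -
  have "P = singles \<union> nontrivial" "singles \<inter> nontrivial = {}"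
    unfolding singles_def nontrivial_def by auto
  then have "(\<Sum>C\<in>P. d C) = (\<Sum>C\<in>singles. d C) + (\<Sum>C\<in>nontrivial. d C)"
    using finP by (metis finite_Un sum.union_disjoint)
  moreover have "(\<Sum>C\<in>singles. d C) = (\<Sum>C\<in>singles. r)"
    by (intro sum.cong) (auto simp: singles_def singleton_boundary)
  ultimately show ?thesis by simp
qed

lemma card_parts: "card P = card singles + card nontrivial"
proof -
  have "P = singles \<union> nontrivial" "singles \<inter> nontrivial = {}"
    unfolding singles_def nontrivial_def by auto
  then show ?thesis using finP by (metis card_Un_disjoint finite_Un)
qed

lemma singles_nbr:
  assumes "{x, y} \<in> E" and "x \<in> \<Union>singles"
  shows "y \<in> A"
proof (rule ccontr)
  assume y: "y \<notin> A"
  obtain C where C: "C \<in> P" "card C = 1" "x \<in> C" using assms(2) unfolding singles_def by auto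
  then have "x \<notin> A" using part_subset by auto
  then have "y \<in> C" using edge_in_part[OF assms(1) _ y C(1,3)] by simp
  then have "x = y" using C by (auto simp: card_1_singleton_iff)
  then show False using edge_card[OF assms(1)] by simp
qed

text \<open>Outside the nontrivial parts the graph without the edges inside \<open>A\<close> is bipartite, so an odd
  ear uses an edge inside \<open>A\<close> or enters and leaves a nontrivial part.\<close>

lemma ears_bound:
  assumes "finite Q" and "edge_disjoint_odd_ears V E U Q"
  shows "2 * card Q \<le> 2 * card (inner_edges E A) + (\<Sum>C\<in>nontrivial. d C)"
proof -
  let ?N = "\<Union>nontrivial" and ?Z = "\<Union>singles"
  let ?w = "ear_weight A ?N"
  have VNZ: "?N \<union> ?Z = V - A" using UnionP unfolding singles_def nontrivial_def by auto
  have ZN: "?Z \<inter> ?N = {}" using parts_disjoint unfolding singles_def nontrivial_def by blast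
  have two: "2 \<le> sum ?w (set (walk_edges p))" if "p \<in> Q" for p
  proof (rule odd_ear_weight)
    show "A \<inter> ?N = {}" "?Z \<inter> (A \<union> ?N) = {}" using VNZ ZN by auto
    show "V = A \<union> ?N \<union> ?Z" using VNZ UV SV by auto
    show "odd_ear V E U p" using assms(2) that unfolding edge_disjoint_odd_ears_def by auto
  qed (use singles_nbr in auto)
  have sub: "set (walk_edges p) \<subseteq> E" if "p \<in> Q" for p
    using assms(2) that unfolding edge_disjoint_odd_ears_def odd_ear_def ear_def is_path_def is_cycle_def
    by auto
  have "2 * card Q = (\<Sum>p\<in>Q. 2)" by simp
  also have "\<dots> \<le> (\<Sum>p\<in>Q. sum ?w (set (walk_edges p)))" using two by (rule sum_mono)
  also have "\<dots> = sum ?w (\<Union>p\<in>Q. set (walk_edges p))"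
    using assms unfolding edge_disjoint_odd_ears_def pairwise_def
    by (intro sum.UNION_disjoint[symmetric]) auto
  also have "\<dots> \<le> sum ?w E" using sub finE by (intro sum_mono2) auto
  also have "\<dots> = (\<Sum>e\<in>E. (if e \<in> inner_edges E A then 2 else 0)
      + (if e \<in> {e \<in> E. e \<inter> A \<noteq> {} \<and> e \<inter> ?N \<noteq> {}} then 1 else 0))"
    using VNZ by (intro sum.cong) (auto simp: ear_weight_def inner_edges_def)
  also have "\<dots> = 2 * card (inner_edges E A) + card {e \<in> E. e \<inter> A \<noteq> {} \<and> e \<inter> ?N \<noteq> {}}"
    using finE unfolding sum.distrib
    by (simp add: sum.If_cases Int_def inner_edges_def conj_ac)
  also have "card {e \<in> E. e \<inter> A \<noteq> {} \<and> e \<inter> ?N \<noteq> {}} = (\<Sum>C\<in>nontrivial. d C)"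
    by (rule card_edges_to_parts) (auto simp: nontrivial_def)
  finally show ?thesis .
qed

text \<open>Besides \<open>C\<close> and \<open>D\<close> at least \<open>card S\<close> parts
  remain, each taking at least \<open>r\<close> of the edges that leave \<open>A\<close>.\<close>

lemma two_parts_bound:
  assumes "C \<in> P" and "D \<in> P" and "C \<noteq> D" and "card S + 2 \<le> card P"
    and "\<And>C. C \<in> P \<Longrightarrow> r \<le> d C"
  shows "d C + d D + r * card S + 2 * card (inner_edges E A) \<le> r * card A"
proof -
  have "card (P - {C, D}) = card P - 2" using assms(1-3) by (simp add: card_Diff_subset)
  then have "card S \<le> card (P - {C, D})" using assms(4) by linarith
  then have "r * card S \<le> r * card (P - {C, D})" by (rule mult_le_mono2)
  also have "\<dots> = (\<Sum>C\<in>P - {C, D}. r)" by simp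
  also have "\<dots> \<le> (\<Sum>C\<in>P - {C, D}. d C)" using assms(5) by (intro sum_mono) auto
  finally have "d C + d D + r * card S \<le> (\<Sum>C\<in>P. d C)"
    using finP assms(1-3) sum.subset_diff[of "{C, D}" P d] by auto
  then show ?thesis using degree_sum_A by linarith
qed

text \<open>In a forest, the edges inside \<open>A\<close> and the edges at the singleton parts can only be
  accommodated if \<open>r \<le> m\<close>. Then every singleton has two neighbours in \<open>S\<close>, which is too many for a
  forest on the singletons and \<open>S\<close>.\<close>

lemma one_nontrivial_part_cycle:
  assumes nt: "nontrivial = {C}" and r: "3 \<le> r" and t: "card singles = Suc (card S)"
    and U: "U \<noteq> {}" and m: "card U = 2 * m" "m \<le> card (inner_edges E A)"
    and few: "\<And>v. r \<le> m \<Longrightarrow> v \<in> V - U \<Longrightarrow> card {u \<in> U. {u, v} \<in> E} \<le> r - 2"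
  shows "\<exists>c. is_cycle (V - C) E c"
proof (rule ccontr)
  assume no: "\<not> ?thesis"
  let ?Z = "\<Union>singles"
  have finZ: "finite ?Z" using finV UnionP by (auto simp: singles_def intro: finite_subset)
  have forest: "card (inner_edges E X) < card X" if X: "X \<subseteq> V - C" "X \<noteq> {}" for X
  proof (rule ccontr)
    assume "\<not> card (inner_edges E X) < card X"
    then have "card X \<le> card {e \<in> E. e \<subseteq> X}" unfolding inner_edges_def by simp
    moreover have "finite X" using X finV by (auto intro: finite_subset)
    ultimately obtain c where "is_cycle X E c"
      using many_edges_imp_cycle[OF _ X(2) edge_card] by blast
    then show False using no is_cycle_mono X(1) by blast
  qed
  have "C \<in> nontrivial" using nt by simp
  then have C: "C \<in> P" "card C \<noteq> 1" unfolding nontrivial_def by auto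
  have VC: "V - C = A \<union> ?Z"
  proof -
    have "\<Union>P = \<Union>nontrivial \<union> ?Z" unfolding nontrivial_def singles_def by auto
    then have "V - A = C \<union> ?Z" using UnionP nt by simp
    moreover have "C \<inter> ?Z = {}"
      using C parts_disjoint[OF C(1)] unfolding singles_def by fastforce
    ultimately show ?thesis using part_subset[OF C(1)] UV SV by blast
  qed
  have ZA: "?Z \<inter> A = {}" using part_subset unfolding singles_def by auto
  have cZ: "card ?Z = card singles"
  proof -
    have "card ?Z = (\<Sum>C\<in>singles. card C)"
      using barrierD(3)[OF barrier]
      by (intro card_Union_disjoint) (auto simp: singles_def disjoint_def pairwise_def disjnt_def
          intro: card_ge_0_finite)
    also have "\<dots> = (\<Sum>C\<in>singles. 1)" by (intro sum.cong) (auto simp: singles_def)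
    finally show ?thesis by simp
  qed
  have cA: "card A = 2 * m + card S"
    using finA SV m(1) by (subst card_Un_disjoint) auto
  define ZE where "ZE = {e \<in> E. e \<inter> A \<noteq> {} \<and> e \<inter> ?Z \<noteq> {}}"
  have "card ZE = (\<Sum>C\<in>singles. d C)"
    unfolding ZE_def by (rule card_edges_to_parts) (auto simp: singles_def)
  also have "\<dots> = (\<Sum>C\<in>singles. r)"
    by (intro sum.cong) (auto simp: singles_def singleton_boundary)
  finally have cZE: "card ZE = r * card singles" by simp
  have "inner_edges E A \<union> ZE \<subseteq> inner_edges E (A \<union> ?Z)"
  proof
    fix e assume e: "e \<in> inner_edges E A \<union> ZE"
    show "e \<in> inner_edges E (A \<union> ?Z)"
    proof (cases "e \<in> inner_edges E A")
      case False
      then have e: "e \<in> E" "e \<inter> A \<noteq> {}" "e \<inter> ?Z \<noteq> {}" using e unfolding ZE_def by auto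
      obtain x y where xy: "e = {x, y}" using edgeE[OF e(1)] .
      have "x \<in> A \<or> y \<in> A" "x \<in> ?Z \<or> y \<in> ?Z" using e(2,3) unfolding xy by blast+
      then have "x \<in> A \<union> ?Z" "y \<in> A \<union> ?Z" using ZA by blast+
      then show ?thesis using e(1) unfolding inner_edges_def xy by blast
    qed (auto simp: inner_edges_def)
  qed
  then have "card (inner_edges E A \<union> ZE) \<le> card (inner_edges E (A \<union> ?Z))"
    using finE by (intro card_mono) (auto simp: inner_edges_def)
  moreover have "card (inner_edges E A \<union> ZE) = card (inner_edges E A) + card ZE"
    using finE ZA by (intro card_Un_disjoint) (auto simp: inner_edges_def ZE_def)
  moreover have "card (inner_edges E (A \<union> ?Z)) < card (A \<union> ?Z)"
    using forest VC U by simp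
  moreover have "card (A \<union> ?Z) = card A + card ?Z"
    using finA finZ ZA by (intro card_Un_disjoint) auto
  \<comment> \<open>The forest on \<open>A\<close> and the singletons contains \<open>m\<close>
    edges inside \<open>A\<close> and \<open>r\<close> at each singleton. Together with
    \<open>3 \<le> r\<close> this inequality forces \<open>r \<le> m\<close>, which makes
    \<open>few\<close> applicable.\<close>
  ultimately have "m + r * Suc (card S) < 2 * m + card S + Suc (card S)"
    using m(2) cZE cA cZ t by simp
  moreover have "3 * card S \<le> r * card S" using r by (rule mult_le_mono1)
  ultimately have rm: "r \<le> m" unfolding mult_Suc_right by linarith
  \<comment> \<open>All \<open>r\<close> edges at \<open>z\<close> end in \<open>A\<close>, and at
    most \<open>r - 2\<close> of them in \<open>U\<close>.\<close>
  have nbrs: "2 \<le> card {e \<in> E. z \<in> e \<and> e \<subseteq> ?Z \<union> S}" if z: "z \<in> ?Z" for z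
  proof -
    have zV: "z \<in> V" "z \<in> V - U" using z ZA VC by auto
    let ?I = "(\<lambda>u. {u, z}) ` {u \<in> U. {u, z} \<in> E}"
    have "{e \<in> E. z \<in> e} \<subseteq> {e \<in> E. z \<in> e \<and> e \<subseteq> ?Z \<union> S} \<union> ?I"
    proof
      fix e assume "e \<in> {e \<in> E. z \<in> e}"
      then have e: "e \<in> E" "z \<in> e" by auto
      obtain y where y: "e = {z, y}" using edgeE[OF e(1)] e(2) by (metis insertE insert_commute singletonD)
      then have "y \<in> A" using singles_nbr[of z y] e z by auto
      then show "e \<in> {e \<in> E. z \<in> e \<and> e \<subseteq> ?Z \<union> S} \<union> ?I"
        using e(1) z unfolding y by (auto simp: insert_commute)
    qed
    then have "card {e \<in> E. z \<in> e} \<le> card ({e \<in> E. z \<in> e \<and> e \<subseteq> ?Z \<union> S} \<union> ?I)"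
      using finE finA by (intro card_mono) auto
    also have "\<dots> \<le> card {e \<in> E. z \<in> e \<and> e \<subseteq> ?Z \<union> S} + card ?I" by (rule card_Un_le)
    also have "card ?I \<le> card {u \<in> U. {u, z} \<in> E}" using finA by (intro card_image_le) auto
    also have "\<dots> \<le> r - 2" using few[OF rm zV(2)] .
    finally show ?thesis using regular zV(1) r unfolding regular_def by simp
  qed
  have "2 * card ?Z = (\<Sum>z\<in>?Z. 2)" by simp
  also have "\<dots> \<le> (\<Sum>z\<in>?Z. card {e \<in> E. z \<in> e \<and> e \<subseteq> ?Z \<union> S})" using nbrs by (rule sum_mono)
  \<comment> \<open>Edges at singletons end in \<open>A\<close>, so none is counted for two of them.
    The resulting bound \<open>2 * card ?Z < card ?Z + card S\<close> contradicts
    \<open>t\<close>.\<close>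
  also have "\<dots> = card (\<Union>z\<in>?Z. {e \<in> E. z \<in> e \<and> e \<subseteq> ?Z \<union> S})"
  proof (rule card_UN_disjoint[symmetric])
    show "\<forall>x\<in>?Z. \<forall>y\<in>?Z. x \<noteq> y \<longrightarrow>
      {e \<in> E. x \<in> e \<and> e \<subseteq> ?Z \<union> S} \<inter> {e \<in> E. y \<in> e \<and> e \<subseteq> ?Z \<union> S} = {}"
    proof (intro ballI impI, rule ccontr)
      fix x y assume xy: "x \<in> ?Z" "y \<in> ?Z" "x \<noteq> y"
        "{e \<in> E. x \<in> e \<and> e \<subseteq> ?Z \<union> S} \<inter> {e \<in> E. y \<in> e \<and> e \<subseteq> ?Z \<union> S} \<noteq> {}"
      then obtain e where e: "e \<in> E" "x \<in> e" "y \<in> e" by auto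
      obtain a b where "e = {a, b}" using edgeE[OF e(1)] .
      then have "e = {x, y}" using e xy(3) by auto
      then have "y \<in> A" using singles_nbr[of x y] e xy by auto
      then show False using xy(2) ZA by auto
    qed
  qed (use finZ finE in auto)
  also have "\<dots> \<le> card (inner_edges E (?Z \<union> S))"
    using finE by (intro card_mono) (auto simp: inner_edges_def)
  also have "\<dots> < card (?Z \<union> S)"
  proof (rule forest)
    show "?Z \<union> S \<noteq> {}" using cZ t by (metis Un_empty card.empty nat.distinct(1))
  qed (use VC in auto)
  also have "\<dots> \<le> card ?Z + card S" by (rule card_Un_le)
  finally show False using cZ t by simp
qed

end

section \<open>Extending the matching\<close>

theorem theorem8:
  fixes V :: "'a set" and E M :: "'a set set" and k m r :: nat
  assumes "m \<ge> 2" and "r \<ge> 3"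
    and "simple_graph V E" and "regular V E r" and "even (card V)"
    and "matching E M" and "card M = m"
    and "\<exists>P. finite P \<and> card P = k \<and> edge_disjoint_odd_ears V E (\<Union>M) P"
    and "m \<ge> r \<longrightarrow> \<not> (\<exists>v \<in> V - \<Union>M. card {u \<in> \<Union>M. {u, v} \<in> E} \<ge> r - 1)"
    and "(int k = int m * int r - \<lceil>real r / 2\<rceil> + 1 \<and>
            cyclic_edge_connectivity V E
              \<ge> enat (m * r - m + (if even m \<and> even r then 1 else 0))) \<or>
         (int k = int m * int r - int r + 1 \<and>
            odd_cyclic_edge_connectivity V E \<ge> enat ((2 * m - 1) * (r - 1)))"
  shows "extends_to_perfect_matching V E M"
proof (rule ccontr)
  assume no: "\<not> ?thesis"
  define U where "U = \<Union>M"
  define X where "X = V - U"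
  have fV: "finite V" and edge_card: "\<And>e. e \<in> E \<Longrightarrow> card e = 2" and EV: "\<And>e. e \<in> E \<Longrightarrow> e \<subseteq> V"
    using assms(3) unfolding simple_graph_def by auto
  have M: "M \<subseteq> E" "disjoint M" using assms(6) unfolding matching_def by auto
  have UV: "U \<subseteq> V" using M EV unfolding U_def by blast
  have fX: "finite X" using fV unfolding X_def by simp
  have "finite e" if "e \<in> M" for e using EV M that fV by (meson finite_subset subsetD)
  then have "card U = (\<Sum>e\<in>M. card e)"
    unfolding U_def using M(2) by (intro card_Union_disjoint)
  also have "\<dots> = (\<Sum>e\<in>M. 2)" using M edge_card by (intro sum.cong) auto
  finally have cU: "card U = 2 * m" using assms(7) by simp
  have "card X = card V - card U"
    unfolding X_def using UV fV by (intro card_Diff_subset) (auto intro: finite_subset)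
  then have evX: "even (card X)" using assms(5) cU by simp
  have noX: "\<nexists>N. perfect_matching X E N"
  proof
    assume "\<exists>N. perfect_matching X E N"
    then obtain N where N: "N \<subseteq> E" "disjoint N" "\<Union>N = X"
      unfolding perfect_matching_def matching_def by auto
    have "disjoint (M \<union> N)"
      using M N by (intro disjoint_union) (auto simp: X_def U_def)
    moreover have "\<Union>(M \<union> N) = V" using N(3) UV unfolding X_def U_def by auto
    ultimately have "perfect_matching V E (M \<union> N)"
      using M N unfolding perfect_matching_def matching_def by auto
    then show False using no unfolding extends_to_perfect_matching_def by blast
  qed
  \<comment> \<open>The number of parts is maximized among the barriers violating Tutte's condition;
    this maximality yields the odd cycles in nontrivial parts.\<close>
  define bad where "bad n \<longleftrightarrow> (\<exists>S P. barrier E X S P \<and> card S < card P \<and> card P = n)" for n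
  have bad_ex: "\<exists>n. bad n" using tutte[OF fX edge_card noX] unfolding bad_def by blast
  have bad_le: "n \<le> card X" if "bad n" for n
    using that barrier_card_le fX unfolding bad_def by blast
  obtain n where n: "bad n" "\<forall>n'. bad n' \<longrightarrow> n' \<le> n"
    using bad_ex Nat.ex_has_greatest_nat[of bad _ "card X"] bad_le by metis
  then obtain S P where b: "barrier E X S P" and SP: "card S < card P" and cP: "card P = n"
    unfolding bad_def by blast
  have max: "card P' \<le> card P" if "barrier E X S' P'" "card S' < card P'" for S' P'
  proof -
    have "bad (card P')" using that unfolding bad_def by blast
    then show ?thesis using n(2) cP by simp
  qed
  have "even (card S + card P)" using barrier_parity[OF b fX] evX by simp
  then have SP2: "card S + 2 \<le> card P" using SP by presburger
  interpret regular_barrier V E r U S P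
    using assms(3,4) UV b unfolding X_def by unfold_locales
  have odd_cycle: "\<exists>c. is_cycle C E c \<and> odd (length (walk_edges c))" if "C \<in> nontrivial" for C
    using barrier_part_odd_cycle[OF fX edge_card b SP max] that unfolding nontrivial_def by auto
  have nontrivialD: "C \<in> P" "C \<subseteq> V" if "C \<in> nontrivial" for C
    using that part_subset unfolding nontrivial_def by auto
  have other: "\<exists>c. is_cycle (V - C) E c" if CD: "C \<in> nontrivial" "D \<in> nontrivial" "C \<noteq> D" for C D
  proof -
    obtain c where "is_cycle D E c" using odd_cycle[OF CD(2)] by blast
    moreover have "D \<subseteq> V - C"
      using barrierD(7)[OF barrier, of C D] nontrivialD[OF CD(1)] nontrivialD[OF CD(2)] CD(3) by blast
    ultimately show ?thesis using is_cycle_mono by blast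
  qed
  define e where "e = card (inner_edges E A)"
  have "M \<subseteq> inner_edges E A" using M unfolding inner_edges_def U_def by auto
  then have me: "m \<le> e" unfolding e_def using assms(7) finE
    by (metis card_mono finite_subset inner_edges_def mem_Collect_eq subsetI)
  have cA: "card A = 2 * m + card S"
    using finA SV cU by (subst card_Un_disjoint) auto
  obtain Q where "finite Q" "card Q = k" "edge_disjoint_odd_ears V E U Q"
    using assms(8) unfolding U_def by blast
  then have ears: "2 * k \<le> 2 * e + (\<Sum>C\<in>nontrivial. d C)"
    using ears_bound unfolding e_def by blast
  have total: "r * (2 * m + card S) = r * card singles + (\<Sum>C\<in>nontrivial. d C) + 2 * e"
    using degree_sum_A sum_boundary_split cA unfolding e_def by simp
  \<comment> \<open>Comparing \<open>ears\<close> with \<open>total\<close> eliminates both the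
    edges inside \<open>A\<close> and the boundaries of the nontrivial parts.\<close>
  have t: "2 * k + r * card singles \<le> 2 * m * r + r * card S"
    using ears total by (simp add: algebra_simps)
  have fin_nt: "finite nontrivial" using finP unfolding nontrivial_def by auto
  have m1: "2 * (r - 1) \<le> m * (r - 1)" using assms(1) by simp
  have mr: "m * r = m * (r - 1) + m" using assms(2) by (cases r) auto
  \<comment> \<open>Since \<open>A\<close> contains at least \<open>m\<close> edges, the two
    boundaries have at most \<open>2 * (m * (r - 1))\<close> edges together. So \<open>L\<close> and
    both boundaries equal \<open>m * (r - 1)\<close>, and \<open>odd\<close> then contradicts that
    the boundary of a part has the parity of \<open>r\<close>.\<close>
  have two_parts: False
    if C: "C \<in> nontrivial" and D: "D \<in> nontrivial" "C \<noteq> D"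
      and big: "\<And>C. C \<in> nontrivial \<Longrightarrow> L \<le> d C" and L: "m * (r - 1) \<le> L"
      and odd: "L = m * (r - 1) \<Longrightarrow> odd (m * (r - 1) + r)" for C D L
  proof -
    have "r \<le> d C" if "C \<in> P" for C
    proof (cases "card C = 1")
      case True
      then show ?thesis using singleton_boundary that by simp
    next
      case False
      then have "L \<le> d C" using big that unfolding nontrivial_def by auto
      then show ?thesis using L m1 assms(2) by linarith
    qed
    then have "d C + d D + r * card S + 2 * e \<le> r * (2 * m + card S)"
      using two_parts_bound[of C D] nontrivialD C D SP2 cA unfolding e_def by auto
    then have "d C + d D \<le> 2 * (m * (r - 1))" using me mr by (simp add: algebra_simps)
    moreover have "L \<le> d C" "L \<le> d D" using big C D by auto
    ultimately have "L = m * (r - 1)" "d C = m * (r - 1)" using L by linarith+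
    then show False using part_boundary_parity[of C] nontrivialD(1)[OF C] odd by auto
  qed
  show False
    using assms(10)
  proof
    assume i: "int k = int m * int r - \<lceil>real r / 2\<rceil> + 1 \<and>
            cyclic_edge_connectivity V E
              \<ge> enat (m * r - m + (if even m \<and> even r then 1 else 0))"
    define L where "L = m * r - m + (if even m \<and> even r then 1 else 0)"
    \<comment> \<open>Rounding up costs at most one half, so \<open>2 * k\<close> is at least
      \<open>2 * m * r - r + 1\<close>: just enough for the strict inequality that gives
      \<open>card singles \<le> card S\<close>.\<close>
    have "2 * \<lceil>real r / 2\<rceil> \<le> int r + 1" by linarith
    then have "2 * int k \<ge> int (2 * m * r) - int r + 1" using i by simp
    then have "2 * m * r + 1 \<le> 2 * k + r" by linarith
    then have "r * card singles < r * Suc (card S)" using t by simp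
    then have "card singles \<le> card S" unfolding mult_less_cancel1 by simp
    then have "2 \<le> card nontrivial" using SP2 card_parts by linarith
    then obtain C D where CD: "C \<in> nontrivial" "D \<in> nontrivial" "C \<noteq> D"
      by (metis card_2_iff' card_le_Suc0_iff_eq fin_nt not_less_eq_eq numeral_2_eq_2)
    have "L \<le> d C'" if C': "C' \<in> nontrivial" for C'
    proof -
      obtain D' where "D' \<in> nontrivial" "C' \<noteq> D'" using CD by metis
      then obtain c c' where c: "is_cycle C' E c" "is_cycle (V - C') E c'"
        using odd_cycle[OF C'] other[OF C'] by blast
      have "cyclic_edge_cut V E (boundary E C')"
        using boundary_cyclic_edge_cut(1)[OF edge_card nontrivialD(2)[OF C'] c] .
      then have "cyclic_edge_connectivity V E \<le> enat (d C')"
        unfolding cyclic_edge_connectivity_def by (intro INF_lower) simp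
      then have "enat L \<le> enat (d C')" using i unfolding L_def by (meson order_trans)
      then show ?thesis by simp
    qed
    moreover have "m * (r - 1) \<le> L" unfolding L_def mr by simp
    \<comment> \<open>Equality means that the correction term is zero, so \<open>m\<close> or
      \<open>r\<close> is odd. In each such case \<open>m * (r - 1)\<close> and \<open>r\<close>
      have different parities.\<close>
    moreover have "odd (m * (r - 1) + r)" if "L = m * (r - 1)"
      using that assms(2) unfolding L_def mr by (auto split: if_splits)
    ultimately show False using two_parts[OF CD] by blast
  next
    assume ii: "int k = int m * int r - int r + 1 \<and>
            odd_cyclic_edge_connectivity V E \<ge> enat ((2 * m - 1) * (r - 1))"
    define L where "L = (2 * m - 1) * (r - 1)"
    have L: "m * (r - 1) + (r - 1) \<le> L"
    proof -
      \<comment> \<open>\<open>m + 1 \<le> 2 * m - 1\<close> because \<open>m\<close> is at least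
        two.\<close>
      have "Suc m * (r - 1) \<le> L" unfolding L_def using assms(1) by (intro mult_le_mono1) simp
      then show ?thesis by simp
    qed
    have big: "L \<le> d C" if C: "C \<in> nontrivial" and c': "\<exists>c. is_cycle (V - C) E c" for C
    proof -
      obtain c c' where c: "is_cycle C E c" "is_cycle (V - C) E c'" "odd (length (walk_edges c))"
        using odd_cycle[OF C] c' by blast
      have "odd_cyclic_edge_cut V E (boundary E C)"
        using boundary_cyclic_edge_cut(2)[OF edge_card nontrivialD(2)[OF C] c] .
      then have "odd_cyclic_edge_connectivity V E \<le> enat (d C)"
        unfolding odd_cyclic_edge_connectivity_def by (intro INF_lower) simp
      then have "enat L \<le> enat (d C)" using ii unfolding L_def by (meson order_trans)
      then show ?thesis by simp
    qed
    \<comment> \<open>Here the ears leave a slack of \<open>2 * r - 2\<close>, so one singleton more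
      than \<open>card S\<close> is possible and a single nontrivial part must be
      considered.\<close>
    have "int (2 * k + 2 * r) = int (2 * m * r + 2)" using ii by simp
    then have "2 * k + 2 * r = 2 * m * r + 2" by linarith
    then have "r * card singles < r * (card S + 2)" using t by (simp add: algebra_simps)
    then have ts: "card singles \<le> card S + 1" unfolding mult_less_cancel1 by simp
    then have "nontrivial \<noteq> {}" using SP2 card_parts by auto
    then obtain C where C: "C \<in> nontrivial" by blast
    show False
    proof (cases "nontrivial = {C}")
      case False
      then obtain D where D: "D \<in> nontrivial" "C \<noteq> D" using C by blast
      have "L \<le> d C'" if C': "C' \<in> nontrivial" for C'
        using big[OF C'] other[OF C'] C D by metis
      \<comment> \<open>\<open>L\<close> exceeds \<open>m * (r - 1)\<close>, so no parity argument
        is needed.\<close>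
      moreover have "L \<noteq> m * (r - 1)" "m * (r - 1) \<le> L" using L assms(2) by auto
      ultimately show False using two_parts[OF C D] by blast
    next
      case nt: True
      then have ts': "card singles = Suc (card S)" using ts SP2 card_parts by simp
      have "\<exists>c. is_cycle (V - C) E c"
      proof (rule one_nontrivial_part_cycle[OF nt assms(2) ts'])
        show "U \<noteq> {}" using cU assms(1) by auto
        show "card {u \<in> U. {u, v} \<in> E} \<le> r - 2" if "r \<le> m" "v \<in> V - U" for v
        proof -
          have "\<not> (\<exists>v \<in> V - U. r - 1 \<le> card {u \<in> U. {u, v} \<in> E})"
            using assms(9) \<open>r \<le> m\<close> unfolding U_def by (rule mp)
          then have "\<not> r - 1 \<le> card {u \<in> U. {u, v} \<in> E}" using that(2) by blast
          then show ?thesis by linarith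
        qed
      qed (use cU me in \<open>auto simp: e_def\<close>)
      then have le: "L \<le> d C" using big C by blast
      have "d C + r * Suc (card S) + 2 * e = r * (2 * m + card S)"
        using total nt ts' by simp
      \<comment> \<open>With \<open>m \<le> e\<close> this gives at most
        \<open>2 * m * r - 2 * m - r\<close> boundary edges, exactly one less than
        \<open>L\<close>.\<close>
      then have sum: "d C + r + 2 * e = 2 * (m * r)" by (simp add: algebra_simps)
      have "(2 * m - 1) * (r - 1) + (r - 1) = Suc (2 * m - 1) * (r - 1)" by simp
      then have "(2 * m - 1) * (r - 1) + (r - 1) = 2 * (m * (r - 1))"
        using assms(1) by (simp add: Suc_diff_1[of "2 * m"] mult.assoc del: mult_Suc)
      then show False using le sum me mr assms(2) unfolding L_def by linarith
    qed
  qed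
qed

end
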